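(* Let $m,d\ge 2$ be integers. There is a number $N_c(m)$ with $$2\log_d m<N_c(m)\le 12\,m^3\,(7+\log_2 m)$$ such that for every prime number $N>N_c(m)$ the set $\mathrm{tiMPS}(N,m,d)$ of normalized translation-invariant matrix product states with periodic boundary conditions is not a closed subset of $(\mathbb C^d)^{\otimes N}$.
   Context: $\mathbb C^d$ has orthonormal basis $\{|\sigma\rangle:\sigma=1,\dots,d\}$ and $(\mathbb C^d)^{\otimes N}$ has product basis $|\boldsymbol\sigma\rangle=|\sigma_1\rangle\otimes\dots\otimes|\sigma_N\rangle$. Closedness is with respect to the norm topology. $\mathrm{tiMPS}(N,m,d)$ is the set of all states $$|\Psi(A)\rangle=\sum_{\boldsymbol\sigma}\operatorname{Tr}\!\left(A^{\sigma_1}A^{\sigma_2}\cdots A^{\sigma_N}\right)|\boldsymbol\sigma\rangle\quad\text{with}\quad\|\Psi(A)\|=1,$$ where $A\in\mathbb C^{d\times m\times m}$ is a single order-3 tensor (the same for every site), regarded as a collection of $m\times m$ matrices $A^1,\dots,A^d$. *)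

theory Defs
  imports "HOL-Analysis.L2_Norm" "HOL-Analysis.Abstract_Metric_Spaces"
    "HOL-Computational_Algebra.Primes" "Jordan_Normal_Form.Matrix"
begin

definition configs :: "nat \<Rightarrow> nat \<Rightarrow> nat list set" where
  "configs N d = {\<sigma>. length \<sigma> = N \<and> set \<sigma> \<subseteq> {1..d}}"

text \<open>A vector of the \<open>N\<close>-fold tensor power of \<open>\<complex>\<^sup>d\<close> is represented by its coefficients in
  the orthonormal product basis, which is indexed by \<^term>\<open>configs N d\<close>. Coefficients at all other
  lists are fixed to be \<open>0\<close>, so that equality of vectors is equality of functions.\<close>

definition tensor_space :: "nat \<Rightarrow> nat \<Rightarrow> (nat list \<Rightarrow> complex) set" where
  "tensor_space N d = {\<psi>. \<forall>\<sigma>. \<sigma> \<notin> configs N d \<longrightarrow> \<psi> \<sigma> = 0}"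

definition tensor_norm :: "nat \<Rightarrow> nat \<Rightarrow> (nat list \<Rightarrow> complex) \<Rightarrow> real" where
  "tensor_norm N d \<psi> = L2_set (\<lambda>\<sigma>. cmod (\<psi> \<sigma>)) (configs N d)"

definition tensor_dist ::
    "nat \<Rightarrow> nat \<Rightarrow> (nat list \<Rightarrow> complex) \<Rightarrow> (nat list \<Rightarrow> complex) \<Rightarrow> real" where
  "tensor_dist N d \<phi> \<psi> = tensor_norm N d (\<lambda>\<sigma>. \<phi> \<sigma> - \<psi> \<sigma>)"

lemma finite_configs: "finite (configs N d)"
  using finite_lists_length_eq[of "{1..d}" N] by (simp add: configs_def conj_commute)

lemma Metric_space_tensor: "Metric_space (tensor_space N d) (tensor_dist N d)"
proof
  fix \<phi> \<psi> :: "nat list \<Rightarrow> complex"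
  show "0 \<le> tensor_dist N d \<phi> \<psi>"
    by (simp add: tensor_dist_def tensor_norm_def)
  show "tensor_dist N d \<phi> \<psi> = tensor_dist N d \<psi> \<phi>"
    by (simp add: tensor_dist_def tensor_norm_def norm_minus_commute)
next
  fix \<phi> \<psi> assume "\<phi> \<in> tensor_space N d" "\<psi> \<in> tensor_space N d"
  then show "tensor_dist N d \<phi> \<psi> = 0 \<longleftrightarrow> \<phi> = \<psi>"
    by (auto simp: tensor_dist_def tensor_norm_def tensor_space_def finite_configs
        L2_set_eq_0_iff fun_eq_iff)
next
  fix \<phi> \<psi> \<omega> :: "nat list \<Rightarrow> complex"
  have "tensor_dist N d \<phi> \<omega>
      \<le> L2_set (\<lambda>\<sigma>. cmod (\<phi> \<sigma> - \<psi> \<sigma>) + cmod (\<psi> \<sigma> - \<omega> \<sigma>)) (configs N d)"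
    unfolding tensor_dist_def tensor_norm_def
    by (intro L2_set_mono norm_diff_triangle_le[OF order_refl order_refl]) simp
  also have "\<dots> \<le> tensor_dist N d \<phi> \<psi> + tensor_dist N d \<psi> \<omega>"
    unfolding tensor_dist_def tensor_norm_def by (rule L2_set_triangle_ineq)
  finally show "tensor_dist N d \<phi> \<omega> \<le> tensor_dist N d \<phi> \<psi> + tensor_dist N d \<psi> \<omega>" .
qed

definition tensor_topology :: "nat \<Rightarrow> nat \<Rightarrow> (nat list \<Rightarrow> complex) topology" where
  "tensor_topology N d = Metric_space.mtopology (tensor_space N d) (tensor_dist N d)"

definition mat_trace :: "complex mat \<Rightarrow> complex" where
  "mat_trace X = (\<Sum>i<dim_row X. X $$ (i, i))"

definition site_prod :: "nat \<Rightarrow> (nat \<Rightarrow> complex mat) \<Rightarrow> nat list \<Rightarrow> complex mat" where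
  "site_prod m A \<sigma> = foldr (\<lambda>s X. A s * X) \<sigma> (1\<^sub>m m)"

definition mps_state :: "nat \<Rightarrow> nat \<Rightarrow> nat \<Rightarrow> (nat \<Rightarrow> complex mat) \<Rightarrow> nat list \<Rightarrow> complex" where
  "mps_state N m d A = (\<lambda>\<sigma>. if \<sigma> \<in> configs N d then mat_trace (site_prod m A \<sigma>) else 0)"

definition tiMPS :: "nat \<Rightarrow> nat \<Rightarrow> nat \<Rightarrow> (nat list \<Rightarrow> complex) set" where
  "tiMPS N m d = {mps_state N m d A | A.
     (\<forall>s\<in>{1..d}. A s \<in> carrier_mat m m) \<and> tensor_norm N d (mps_state N m d A) = 1}"

text \<open>\<^const>\<open>closedin\<close> also demands that the set lies in the ambient space, which holds here.\<close>

lemma tiMPS_subset_topspace: "tiMPS N m d \<subseteq> topspace (tensor_topology N d)"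
  unfolding tensor_topology_def Metric_space.topspace_mtopology[OF Metric_space_tensor]
  by (auto simp: tiMPS_def mps_state_def tensor_space_def)

end

theory Submission
  imports "Jordan_Normal_Form.Schur_Decomposition" Defs
begin

text \<open>The W state, whose coefficient is \<open>1\<close> at the words with exactly one \<open>2\<close> and otherwise \<open>1\<close>s, is a
  limit of states of bond dimension 2. Suppose that it is given by matrices of size \<open>m\<close>; write
  \<open>X\<close> and \<open>Y\<close> for those of the letters \<open>1\<close> and \<open>2\<close>. Cut down to the part on which \<open>X\<close> is invertible
  and normalize the products of length \<open>L\<close> that contain \<open>Y\<close> by the factor \<open>X\<close> to the power \<open>-L\<close>.
  Their spans increase with \<open>L\<close>, so they become stationary after as many steps as the dimension of
  the matrix algebra allows; the stationary value is an algebra \<open>B\<close> normalized by \<open>X\<close>.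
  The trace form of \<open>B\<close> yields an element \<open>p\<close> of \<open>B\<close> that is a unit modulo a nil ideal. Nil algebras are
  nilpotent, so replacing one factor \<open>Y\<close> by \<open>p Y\<close> does not change the trace of a word with
  one \<open>Y\<close>. But \<open>p Y\<close> contains \<open>Y\<close> at least twice, and all such words have trace \<open>0\<close>.\<close>

section \<open>Algebras with a trace\<close>

text \<open>The ambient type may be infinite-dimensional, and \<open>dim\<close> is 0 where there is
  no finite basis; the finite set \<open>S\<close> guards the comparison.\<close>

lemma dim_mono_span:
  fixes V W :: "'a::real_vector set"
  assumes "V \<subseteq> W" "W \<subseteq> span S" "finite S"
  shows "dim V \<le> dim W"
proof -
  obtain B where B: "B \<subseteq> V" "independent B" "V \<subseteq> span B" "card B = dim V"
    using real_vector.basis_exists by blast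
  obtain C where C: "C \<subseteq> W" "independent C" "W \<subseteq> span C" "card C = dim W"
    using real_vector.basis_exists by blast
  have "finite C"
    using real_vector.independent_span_bound[OF assms(3) C(2)] C(1) assms(2) by blast
  then show ?thesis
    using real_vector.independent_span_bound[OF _ B(2), of C] B C assms(1) by force
qed

lemma subspace_eqI_dim:
  fixes V W :: "'a::real_vector set"
  assumes "subspace V" "V \<subseteq> W" "W \<subseteq> span S" "finite S" "dim W \<le> dim V"
  shows "V = W"
proof (rule ccontr)
  assume "V \<noteq> W"
  then obtain w where w: "w \<in> W" "w \<notin> V" using assms(2) by blast
  obtain B where B: "B \<subseteq> V" "independent B" "V \<subseteq> span B" "card B = dim V"
    using real_vector.basis_exists by blast
  have fB: "finite B"
    using real_vector.independent_span_bound[OF assms(4) B(2)] B(1) assms(2,3) by blast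
  have "w \<notin> span B"
    using w(2) real_vector.span_minimal[OF B(1) assms(1)] by blast
  then have ind: "independent (insert w B)"
    using B(2) real_vector.independent_insertI by blast
  have "w \<notin> B" using w B by blast
  then have "Suc (dim V) = card (insert w B)" using B fB by simp
  also have "\<dots> = dim (insert w B)"
    using real_vector.dim_eq_card_independent[OF ind] by simp
  also have "\<dots> \<le> dim W"
    using dim_mono_span[OF _ assms(3,4), of "insert w B"] w B assms(2) by blast
  finally show False using assms(5) by simp
qed

text \<open>An injective linear map sends a basis to an independent set, so the image has the
  dimension of \<open>V\<close> and cannot be a proper subspace. Later this shows that conjugation
  by the inverse of \<open>X\<close> preserves \<open>B\<close>.\<close>

lemma linear_inj_on_subspace_surj:
  fixes f :: "'a::real_vector \<Rightarrow> 'a"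
  assumes "linear f" "subspace V" "V \<subseteq> span S" "finite S" "f ` V \<subseteq> V" "inj_on f V"
  shows "f ` V = V"
proof (rule subspace_eqI_dim[OF _ assms(5,3,4)])
  show "subspace (f ` V)"
    using assms(1,2) real_vector.linear_subspace_image by blast
  obtain B where B: "B \<subseteq> V" "independent B" "V \<subseteq> span B" "card B = dim V"
    using real_vector.basis_exists by blast
  have sB: "span B = V"
    using B real_vector.span_minimal[OF B(1) assms(2)] by blast
  have "independent (f ` B)"
    using real_vector.linear_independent_injective_image[OF assms(1) B(2)] assms(6) sB
    by simp
  then have "dim (f ` B) = card (f ` B)"
    using real_vector.dim_eq_card_independent by blast
  also have "\<dots> = dim V"
    using B card_image inj_on_subset[OF assms(6) B(1)] by metis
  finally show "dim V \<le> dim (f ` V)"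
    using dim_mono_span[OF _ _ assms(4), of "f ` B" "f ` V"] assms(3,5) B(1) by fastforce
qed

text \<open>Each strict inclusion raises the dimension by at least 1, and no dimension exceeds
  \<open>card S\<close>.\<close>

lemma subspace_chain_stabilizes:
  fixes J :: "nat \<Rightarrow> 'a::real_vector set"
  assumes "\<And>n. subspace (J n)" "\<And>n. J n \<subseteq> J (Suc n)" "\<And>n. J n \<subseteq> span S"
    and S: "finite S"
  shows "\<exists>n\<le>card S. J n = J (Suc n)"
proof (rule ccontr)
  assume *: "\<not> ?thesis"
  have "n \<le> dim (J n)" if "n \<le> Suc (card S)" for n
    using that
  proof (induction n)
    case (Suc n)
    then have "J n \<noteq> J (Suc n)" using * by auto
    then have "\<not> dim (J (Suc n)) \<le> dim (J n)"
      using subspace_eqI_dim[OF assms(1,2,3) S] by blast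
    then show ?case using Suc by simp
  qed simp
  from this[of "Suc (card S)"] real_vector.dim_le_card[OF assms(3) S, of "Suc (card S)"]
  show False by simp
qed

text \<open>Induction on \<open>F\<close>: a suitable multiple of \<open>f t\<close> is subtracted
  from \<open>g\<close>, so that the difference vanishes on the common kernel of the remaining
  functionals.\<close>

lemma linear_functional_representation:
  fixes g :: "'a::real_vector \<Rightarrow> real" and f :: "'b \<Rightarrow> 'a \<Rightarrow> real"
  assumes "finite F" "subspace V" "linear g" "\<And>s. s \<in> F \<Longrightarrow> linear (f s)"
    and "\<And>x. x \<in> V \<Longrightarrow> (\<And>s. s \<in> F \<Longrightarrow> f s x = 0) \<Longrightarrow> g x = 0"
  shows "\<exists>c. \<forall>x\<in>V. g x = (\<Sum>s\<in>F. c s * f s x)"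
  using assms
proof (induction F arbitrary: g rule: finite_induct)
  case empty
  then show ?case by simp
next
  case (insert t F)
  have lin: "linear (\<lambda>x. g x - r * f t x)" for r
    using insert.prems(2) insert.prems(3)[of t]
    by (simp add: linear_iff algebra_simps)
  have "\<exists>r. \<forall>x\<in>V. (\<forall>s\<in>F. f s x = 0) \<longrightarrow> g x - r * f t x = 0"
  proof (cases "\<exists>y\<in>V. (\<forall>s\<in>F. f s y = 0) \<and> f t y \<noteq> 0")
    case True
    then obtain y where y: "y \<in> V" "\<forall>s\<in>F. f s y = 0" "f t y \<noteq> 0" by blast
    have "g x - (g y / f t y) * f t x = 0" if x: "x \<in> V" "\<forall>s\<in>F. f s x = 0" for x
    proof -
      \<comment> \<open>The multiple of \<open>y\<close> moves \<open>x\<close> into the kernel of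
        \<open>f t\<close> without leaving the other kernels.\<close>
      define z where "z = x - (f t x / f t y) *\<^sub>R y"
      have "z \<in> V"
        unfolding z_def using x(1) y(1) insert.prems(1)
        by (simp add: real_vector.subspace_diff real_vector.subspace_scale)
      moreover have "f s z = 0" if "s \<in> insert t F" for s
        using insert.prems(3)[OF that] that x(2) y(2,3)
        by (auto simp: z_def linear_diff linear_cmul)
      ultimately have "g z = 0" using insert.prems(4) by blast
      then show ?thesis
        using insert.prems(2) by (simp add: z_def linear_diff linear_cmul field_simps)
    qed
    then show ?thesis by blast
  next
    case False
    then have "\<forall>x\<in>V. (\<forall>s\<in>F. f s x = 0) \<longrightarrow> g x - 0 * f t x = 0"
      using insert.prems(4) by auto
    then show ?thesis by blast
  qed
  then obtain r where "\<forall>x\<in>V. (\<forall>s\<in>F. f s x = 0) \<longrightarrow> g x - r * f t x = 0" by blast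
  then obtain c where c: "\<forall>x\<in>V. g x - r * f t x = (\<Sum>s\<in>F. c s * f s x)"
    using insert.IH[OF insert.prems(1) lin[of r]] insert.prems(3) by blast
  have "(\<Sum>s\<in>insert t F. (c(t := r)) s * f s x) = r * f t x + (\<Sum>s\<in>F. c s * f s x)" for x
    using insert.hyps by (auto intro!: sum.cong)
  then have "\<forall>x\<in>V. g x = (\<Sum>s\<in>insert t F. (c(t := r)) s * f s x)"
    using c by (metis diff_eq_eq add.commute)
  then show ?case by blast
qed

section \<open>Nil subalgebras of an algebra with a trace\<close>

text \<open>\<open>R\<close> stands for the matrices of one size; its unit may differ from the
  \<open>1\<close> of the type. The powers start at \<open>k = 2\<close> because the trace form on a
  subalgebra without a unit controls \<open>tr (x ^ k)\<close> only from there on.\<close>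

locale trace_algebra =
  fixes R :: "'a::real_algebra_1 set" and tr :: "'a \<Rightarrow> real" and D :: nat
  assumes subspace_R: "subspace R"
    and mult_R: "a \<in> R \<Longrightarrow> b \<in> R \<Longrightarrow> a * b \<in> R"
    and spanning_R: "\<exists>S. finite S \<and> card S \<le> D \<and> R \<subseteq> span S"
    and linear_tr: "linear tr"
    and tr_commute: "a \<in> R \<Longrightarrow> b \<in> R \<Longrightarrow> tr (a * b) = tr (b * a)"
    and nilpotent_if_tr_powers:
      "a \<in> R \<Longrightarrow> (\<And>k. k \<ge> 2 \<Longrightarrow> tr (a ^ k) = 0) \<Longrightarrow> \<exists>n. a ^ n = 0"
    and tr_nilpotent: "a \<in> R \<Longrightarrow> a ^ n = 0 \<Longrightarrow> tr a = 0"
begin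

lemma power_R: "a \<in> R \<Longrightarrow> n > 0 \<Longrightarrow> a ^ n \<in> R"
proof (induction n)
  case (Suc n)
  then show ?case by (cases n) (auto intro: mult_R)
qed simp

text \<open>The well-founded part of \<open>R\<close> under left multiplication by \<open>N\<close>:
  every infinite sequence of such multiplications starting in it reaches 0. Its induction principle
  replaces an index of nilpotency.\<close>

inductive_set nil_part :: "'a set \<Rightarrow> 'a set" for N where
  zero: "0 \<in> nil_part N"
| step: "v \<in> R \<Longrightarrow> (\<And>a. a \<in> N \<Longrightarrow> a * v \<in> nil_part N) \<Longrightarrow> v \<in> nil_part N"

context
  fixes N :: "'a set"
  assumes sub: "subspace N" and NR: "N \<subseteq> R" and mult_N: "\<And>a b. a \<in> N \<Longrightarrow> b \<in> N \<Longrightarrow> a * b \<in> N"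
begin

lemma nil_part_R: "v \<in> nil_part N \<Longrightarrow> v \<in> R"
  by (induction rule: nil_part.induct) (auto intro: real_vector.subspace_0 subspace_R)

lemma nil_part_mult: "v \<in> nil_part N \<Longrightarrow> a \<in> N \<Longrightarrow> a * v \<in> nil_part N"
  by (erule nil_part.cases) (auto intro: nil_part.zero)

lemma nil_part_add: "v \<in> nil_part N \<Longrightarrow> u \<in> nil_part N \<Longrightarrow> u + v \<in> nil_part N"
proof (induction arbitrary: u rule: nil_part.induct)
  case (step v)
  show ?case
  proof (rule nil_part.step)
    show "u + v \<in> R"
      using step nil_part_R real_vector.subspace_add subspace_R by blast
    show "a * (u + v) \<in> nil_part N" if "a \<in> N" for a
      using step.IH[OF that] nil_part_mult[OF step.prems that] by (simp add: distrib_left)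
  qed
qed simp

lemma nil_part_scale: "v \<in> nil_part N \<Longrightarrow> r *\<^sub>R v \<in> nil_part N"
proof (induction rule: nil_part.induct)
  case (step v)
  show ?case
    by (rule nil_part.step)
      (use step real_vector.subspace_scale subspace_R in auto)
qed (simp add: nil_part.zero)

lemma subspace_nil_part: "subspace (nil_part N)"
  by (auto simp: subspace_def nil_part.zero nil_part_add nil_part_scale)

text \<open>Take \<open>v\<close> outside of \<open>nil_part N\<close> such that \<open>N v + nil_part N\<close> is as small as possible, and a
  multiple \<open>u\<close> of \<open>v\<close> by an element of \<open>N\<close> outside of \<open>nil_part N\<close>. Then \<open>u\<close> lies in \<open>b u + nil_part N\<close> for some \<open>b\<close>
  in \<open>N\<close>, which contradicts the nilpotency of \<open>b\<close>.\<close>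

lemma nil_part_eq:
  assumes nil: "\<And>a. a \<in> N \<Longrightarrow> \<exists>n. a ^ n = 0"
  shows "nil_part N = R"
proof (rule ccontr)
  assume "nil_part N \<noteq> R"
  then have ne: "\<exists>v. v \<in> R - nil_part N" using nil_part_R by blast
  define M where "M v = {a * v + k |a k. a \<in> N \<and> k \<in> nil_part N}" for v
  obtain v where v: "v \<in> R - nil_part N"
    and min: "\<And>u. u \<in> R - nil_part N \<Longrightarrow> dim (M v) \<le> dim (M u)"
    using ne ex_has_least_nat[of "\<lambda>v. v \<in> R - nil_part N" _ "\<lambda>v. dim (M v)"] by blast
  obtain S where S: "finite S" "R \<subseteq> span S" using spanning_R by blast
  have M_R: "M u \<subseteq> R" if "u \<in> R" for u
    unfolding M_def using that NR nil_part_R mult_R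
    by (auto intro!: real_vector.subspace_add[OF subspace_R])
  have sub_M: "subspace (M u)" for u
  proof -
    have "linear (\<lambda>a. a * u)" by (simp add: linear_iff algebra_simps)
    then have "subspace ((\<lambda>a. a * u) ` N)"
      using sub real_vector.linear_subspace_image by blast
    from real_vector.subspace_sums[OF this subspace_nil_part]
    show ?thesis
      by (rule back_subst[of subspace]) (auto simp: M_def)
  qed
  obtain c where c: "c \<in> N" "c * v \<notin> nil_part N" using v nil_part.step by blast
  define u where "u = c * v"
  have u: "u \<in> R - nil_part N"
    using c v NR mult_R by (auto simp: u_def)
  have "M u \<subseteq> M v"
    unfolding M_def u_def using c(1) mult_N by (auto simp flip: mult.assoc)
  then have "M u = M v"
    using subspace_eqI_dim[OF sub_M] min[OF u] M_R[of v] v S by (meson DiffD1 order_trans)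
  moreover have "u \<in> M v"
    unfolding M_def u_def using c(1) nil_part.zero by force
  ultimately have "u \<in> M u" by simp
  then obtain b k where b: "b \<in> N" "k \<in> nil_part N" "u = b * u + k"
    unfolding M_def by blast
  have "\<exists>k\<in>nil_part N. u = b ^ n * u + k" for n
  proof (induction n)
    case 0
    then show ?case using nil_part.zero by force
  next
    case (Suc n)
    then obtain k' where k': "k' \<in> nil_part N" "u = b ^ n * u + k'" by blast
    have "u = b * (b ^ n * u + k') + k" using b(3) k'(2) by simp
    then have "u = b ^ Suc n * u + (b * k' + k)" by (simp add: algebra_simps)
    moreover have "b * k' + k \<in> nil_part N"
      using nil_part_mult nil_part_add b k' by blast
    ultimately show ?case by blast
  qed
  moreover obtain n where "b ^ n = 0" using nil b(1) by blast
  ultimately have "u \<in> nil_part N" by (metis mult_zero_left add_0)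
  then show False using u by blast
qed

text \<open>In a power of \<open>z * u\<close>, the factors \<open>u\<close> can be moved to the
  left past elements of \<open>N\<close>, which turn into other elements of \<open>N\<close>. What
  is left is a long product from \<open>N\<close> acting on \<open>R\<close>, which is 0 because
  \<open>nil_part N = R\<close>. So \<open>z * u\<close> is nilpotent.\<close>

lemma tr_nil_mult_normalizing:
  assumes nil: "\<And>a. a \<in> N \<Longrightarrow> \<exists>n. a ^ n = 0"
    and u: "u \<in> R" "\<And>z. z \<in> N \<Longrightarrow> \<exists>z'\<in>N. z * u = u * z'"
    and z: "z \<in> N"
  shows "tr (z * u) = 0"
proof -
  have swap: "\<exists>z'\<in>N. z * u ^ k = u ^ k * z'" if "z \<in> N" for z k
    using that
  proof (induction k arbitrary: z)
    case (Suc k)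
    obtain z' where z': "z' \<in> N" "z * u = u * z'" using u(2)[OF Suc.prems] by blast
    obtain z'' where "z'' \<in> N" "z' * u ^ k = u ^ k * z''" using Suc.IH[OF z'(1)] by blast
    then show ?case using z'(2) by (metis mult.assoc power_Suc)
  qed auto
  \<comment> \<open>\<open>k\<close> counts the factors \<open>u\<close> collected in front of
    \<open>v\<close>. Each factor \<open>z * u\<close> adds one of them and replaces
    \<open>v\<close> by some \<open>z' * v\<close>, to which the induction hypothesis
    applies.\<close>
  have "\<exists>n. (z * u) ^ n * (u ^ k * v) = 0" if "v \<in> nil_part N" for v k
    using that
  proof (induction arbitrary: k rule: nil_part.induct)
    case (step v)
    obtain z' where z': "z' \<in> N" "z * u ^ Suc k = u ^ Suc k * z'" using swap[OF z] by blast
    obtain n where n: "(z * u) ^ n * (u ^ Suc k * (z' * v)) = 0" using step.IH[OF z'(1)] by blast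
    have "(z * u) ^ Suc n * (u ^ k * v) = (z * u) ^ n * (z * u) * (u ^ k * v)"
      by (simp only: power_Suc2)
    also have "\<dots> = (z * u) ^ n * (z * u ^ Suc k * v)"
      by (simp add: mult.assoc)
    also have "\<dots> = 0" using n z'(2) by (simp add: mult.assoc)
    finally show ?case by blast
  qed auto
  moreover have zuR: "z * u \<in> R" using z u NR mult_R by blast
  \<comment> \<open>The vector \<open>v\<close> is \<open>z * u\<close> itself, since
    \<open>1\<close> need not lie in \<open>R\<close>.\<close>
  ultimately obtain n where "(z * u) ^ n * (u ^ 0 * (z * u)) = 0"
    using nil_part_eq[OF nil] by blast
  then have "(z * u) ^ Suc n = 0" by (simp add: power_Suc2 del: power_Suc)
  then show ?thesis using tr_nilpotent[OF zuR] by blast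
qed

end

section \<open>The trace form of a subalgebra and its radical\<close>

text \<open>If \<open>tr (x * s) = 0\<close> for all \<open>s\<close> in \<open>A\<close>, then
  \<open>tr (x ^ k) = 0\<close> for \<open>k \<ge> 2\<close>, so \<open>x\<close> is nilpotent and
  \<open>tr x = 0\<close>. Hence on \<open>A\<close> the trace is a combination of the functionals
  \<open>tr (a * s)\<close> with \<open>s\<close> in a basis, and \<open>p\<close> is the same
  combination of the basis vectors.\<close>

lemma trace_form_unit:
  assumes A: "subspace A" "A \<subseteq> R" "\<And>a b. a \<in> A \<Longrightarrow> b \<in> A \<Longrightarrow> a * b \<in> A"
  shows "\<exists>p\<in>A. \<forall>a\<in>A. tr (a * p) = tr a"
proof -
  obtain S where S: "finite S" "R \<subseteq> span S" using spanning_R by blast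
  obtain B where B: "B \<subseteq> A" "independent B" "A \<subseteq> span B"
    using real_vector.maximal_independent_subset by metis
  have fB: "finite B"
    using real_vector.independent_span_bound[OF S(1) B(2)] B(1) A(2) S(2) by blast
  have lin: "linear (\<lambda>a. tr (a * s))" for s
    using linear_tr by (simp add: linear_iff algebra_simps)
  have lin2: "linear (\<lambda>s. tr (a * s))" for a
    using linear_tr by (simp add: linear_iff algebra_simps)
  have "tr x = 0" if x: "x \<in> A" and 0: "\<And>s. s \<in> B \<Longrightarrow> tr (x * s) = 0" for x
  proof -
    have x0: "tr (x * s) = 0" if "s \<in> A" for s
      using real_vector.linear_eq_0_on_span[OF lin2, of B x] 0 B(3) that by blast
    have "x ^ Suc k \<in> A" for k
      by (induction k) (use x A(3) in auto)
    then have "tr (x ^ Suc (Suc k)) = 0" for k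
      using x0[of "x ^ Suc k"] by simp
    then have "tr (x ^ k) = 0" if "k \<ge> 2" for k
      using that by (metis One_nat_def Suc_1 Suc_le_D Suc_le_mono)
    then show ?thesis
      using nilpotent_if_tr_powers[of x] tr_nilpotent[of x] x A(2) by blast
  qed
  then obtain c where c: "\<forall>x\<in>A. tr x = (\<Sum>s\<in>B. c s * tr (x * s))"
    using linear_functional_representation[OF fB A(1) linear_tr, of "\<lambda>s a. tr (a * s)"] lin
    by blast
  define p where "p = (\<Sum>s\<in>B. c s *\<^sub>R s)"
  have "p \<in> A"
    unfolding p_def using B(1) A(1)
    by (intro real_vector.subspace_sum) (auto intro: real_vector.subspace_scale)
  moreover have "tr (x * p) = (\<Sum>s\<in>B. c s * tr (x * s))" for x
    unfolding p_def
    by (simp add: sum_distrib_left linear_sum[OF linear_tr] linear_cmul[OF linear_tr])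
  ultimately show ?thesis using c by auto
qed

text \<open>\<open>f\<close> is conjugation by \<open>u\<close>, and \<open>g\<close> is its adjoint
  for the trace form. The element \<open>q - p * q\<close> lies in the radical of that form, which
  is nil and stable under \<open>f\<close>, so its product with \<open>u\<close> has trace
  0.\<close>

lemma tr_mult_normalizing_eq:
  assumes A: "subspace A" "A \<subseteq> R" "\<And>a b. a \<in> A \<Longrightarrow> b \<in> A \<Longrightarrow> a * b \<in> A"
    and u: "u \<in> R"
    and f: "\<And>a. a \<in> A \<Longrightarrow> f a \<in> A" "\<And>a. a \<in> A \<Longrightarrow> a * u = u * f a"
    and g: "\<And>a. a \<in> A \<Longrightarrow> g a \<in> A" "\<And>a b. a \<in> A \<Longrightarrow> b \<in> A \<Longrightarrow> tr (f a * b) = tr (a * g b)"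
    and q: "q \<in> A"
  shows "\<exists>p\<in>A. tr (q * u) = tr (p * q * u)"
proof -
  obtain p where p: "p \<in> A" "\<And>a. a \<in> A \<Longrightarrow> tr (a * p) = tr a"
    using trace_form_unit[OF A] by blast
  define N where "N = {a \<in> A. \<forall>b\<in>A. tr (a * b) = 0}"
  have sub: "subspace N"
    using A(1) linear_tr unfolding N_def subspace_def
    by (auto simp: linear_iff algebra_simps linear_0)
  have mult_N: "a * b \<in> N" if "a \<in> N" "b \<in> N" for a b
    using that A(3) unfolding N_def by (auto simp: mult.assoc)
  have nil: "\<exists>n. a ^ n = 0" if a: "a \<in> N" for a
  proof (rule nilpotent_if_tr_powers)
    show "a \<in> R" using a A(2) by (auto simp: N_def)
    have pA: "a ^ Suc k \<in> A" for k
      by (induction k) (use a A(3) in \<open>auto simp: N_def\<close>)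
    fix k :: nat assume "k \<ge> 2"
    then obtain l where "k = Suc (Suc l)" by (metis One_nat_def Suc_1 Suc_le_D Suc_le_mono)
    then show "tr (a ^ k) = 0" using a pA[of l] by (auto simp: N_def)
  qed
  \<comment> \<open>\<open>tr (f z * b) = tr (z * g b) = 0\<close> keeps \<open>f z\<close> in the
    radical.\<close>
  have conj: "\<exists>z'\<in>N. z * u = u * z'" if "z \<in> N" for z
    using that f g by (intro bexI[of _ "f z"]) (auto simp: N_def)
  have "q - p * q \<in> N"
    unfolding N_def
  proof safe
    show "q - p * q \<in> A"
      using A q p(1) real_vector.subspace_diff by blast
    fix b assume b: "b \<in> A"
    \<comment> \<open>Cyclicity moves \<open>p\<close> to the right end, where it acts as a unit
      under the trace.\<close>
    have "tr (p * q * b) = tr (q * b * p)"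
      using tr_commute[of p "q * b"] p(1) q b A(2) mult_R by (auto simp: mult.assoc)
    also have "\<dots> = tr (q * b)" using p(2) q b A(3) by blast
    finally show "tr ((q - p * q) * b) = 0"
      using linear_tr by (simp add: algebra_simps linear_diff)
  qed
  then have "tr ((q - p * q) * u) = 0"
    using tr_nil_mult_normalizing[OF sub _ mult_N nil u conj] A(2) by (auto simp: N_def)
  then have "tr (q * u) = tr (p * q * u)"
    using linear_tr by (simp add: algebra_simps linear_diff)
  then show ?thesis using p(1) by blast
qed

end

section \<open>Words with at least one letter 2\<close>

text \<open>On each side of every 2 there are at least \<open>j\<close> letters 1. Their product
  \<open>X ^ j\<close> annihilates the part on which \<open>X\<close> is nilpotent, so the products
  of these words live where \<open>X\<close> is invertible.\<close>

inductive block_word :: "nat \<Rightarrow> nat list \<Rightarrow> bool" for j where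
  base: "block_word j (replicate j 1 @ [2] @ replicate j 1)"
| left: "block_word j w \<Longrightarrow> block_word j (1 # w)"
| right: "block_word j w \<Longrightarrow> block_word j (w @ [1])"
| snoc: "block_word j w \<Longrightarrow> block_word j (w @ replicate j 1 @ [2] @ replicate j 1)"

lemma block_word_set: "block_word j w \<Longrightarrow> set w \<subseteq> {1, 2}"
  by (induction rule: block_word.induct) auto

lemma block_word_count: "block_word j w \<Longrightarrow> count_list w 2 \<ge> 1"
  by (induction rule: block_word.induct) auto

lemma linear_span_subset:
  assumes "linear f" "\<And>x. x \<in> S \<Longrightarrow> f x \<in> span T" "x \<in> span S"
  shows "f x \<in> span T"
  using assms real_vector.linear_span_image[OF assms(1), of S]
    real_vector.span_minimal[of "f ` S" "span T"] real_vector.subspace_span by blast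

section \<open>Stationary spans of normalized word products\<close>

context trace_algebra
begin

lemma word_R:
  assumes "A 1 \<in> R" "A 2 \<in> R" "w \<noteq> []" "set w \<subseteq> {1, 2}"
  shows "prod_list (map A w) \<in> R"
  using assms(3,4)
proof (induction w)
  case (Cons s w)
  then have "A s \<in> R" using assms by auto
  then show ?case using Cons by (cases "w = []") (auto intro: mult_R)
qed simp

text \<open>\<open>X'\<close> is a quasi-inverse of \<open>A 1\<close>, which is thereby invertible
  on the range of its \<open>j\<close>-th power. The bound on \<open>N\<close> leaves room for the
  at most \<open>D + 1\<close> block lengths after which the spans are stationary, and for one
  further block.\<close>

theorem ex_word_tr_eq_0:
  fixes A :: "nat \<Rightarrow> 'a"
  assumes AR: "A 1 \<in> R" "A 2 \<in> R"
    and X': "X' \<in> R" "A 1 * X' = X' * A 1" "A 1 ^ Suc j * X' = A 1 ^ j" and j: "j > 0"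
    and N: "N \<ge> (D + 2) * (2 * j + 1)"
    and vanish: "\<And>w. length w = N \<Longrightarrow> set w \<subseteq> {1, 2} \<Longrightarrow> count_list w 2 \<ge> 2
      \<Longrightarrow> tr (prod_list (map A w)) = 0"
  shows "\<exists>w. length w = N \<and> set w \<subseteq> {1, 2} \<and> count_list w 2 = 1 \<and> tr (prod_list (map A w)) = 0"
proof -
  define ev where "ev w = prod_list (map A w)" for w
  define T where "T = replicate j 1 @ [2] @ replicate j (1::nat)"
  define X where "X = A 1"
  \<comment> \<open>\<open>E\<close> is the idempotent onto the range of \<open>X ^ j\<close>, and
    \<open>Xi\<close> is the inverse of \<open>X\<close> in the corner cut out by
    \<open>E\<close>.\<close>
  define E where "E = X ^ j * X' ^ j"
  define Xi where "Xi = E * X'"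
  define g where "g = 2 * j + 1"
  note X'X = X'(2)[folded X_def]
  have ev_simps: "ev (v @ w) = ev v * ev w" "ev (1 # w) = X * ev w" "ev [] = 1"
    "ev (replicate n 1) = X ^ n" "ev (Suc 0 # w) = X * ev w" "ev (replicate n (Suc 0)) = X ^ n" for v w n
    by (simp_all add: ev_def X_def prod_list_replicate map_replicate_const)
  have T: "block_word j T" "length T = g" unfolding T_def g_def by (rule block_word.base) simp
  have XR: "X \<in> R" and X'R: "X' \<in> R" using AR X' by (auto simp: X_def)
  have X'p: "X' ^ n * X = X * X' ^ n" for n
    by (simp add: X'X power_commuting_commutes)
  have X'pp: "X' ^ n * X ^ k = X ^ k * X' ^ n" for n k
    by (metis X'p power_commuting_commutes)
  have shift: "X ^ (j + k) * X' ^ k = X ^ j" for k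
  proof (induction k)
    case (Suc k)
    have "X ^ (j + Suc k) = X ^ k * X ^ Suc j"
      by (simp only: power_add[symmetric]) (simp add: add.commute)
    then have "X ^ (j + Suc k) * X' ^ Suc k = X ^ k * (X ^ Suc j * X') * X' ^ k"
      by (simp only: power_Suc[of X'] mult.assoc)
    also have "\<dots> = X ^ (j + k) * X' ^ k"
      using X'(3) by (simp add: X_def add.commute flip: power_add)
    finally show ?case using Suc by simp
  qed simp
  have EX: "E * X = X * E"
    unfolding E_def by (metis X'p mult.assoc power_commutes)
  have EXj: "E * X ^ j = X ^ j"
    unfolding E_def by (metis X'pp mult.assoc power_add shift)
  have XjE: "X ^ j * E = X ^ j"
    by (metis EX EXj power_commuting_commutes)
  have EE: "E * E = E"
    using EXj unfolding E_def by (metis mult.assoc)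
  have EX': "E * X' = X' * E"
    unfolding E_def by (metis X'X mult.assoc power_commutes power_commuting_commutes)
  have XXi: "X * Xi = E"
  proof -
    have "X * Xi = X ^ Suc j * X' * X' ^ j"
      unfolding Xi_def E_def by (metis mult.assoc power_Suc power_Suc2)
    then show ?thesis using X'(3) by (simp add: E_def X_def)
  qed
  have XiX: "Xi * X = E"
    using XXi by (metis EX X'X Xi_def mult.assoc)
  have XiE: "Xi * E = Xi" and EXi: "E * Xi = Xi"
    unfolding Xi_def using EE EX' by (metis mult.assoc)+
  have ER: "E \<in> R" unfolding E_def using XR X'R j by (intro mult_R power_R)
  have XiR: "Xi \<in> R" unfolding Xi_def using ER X'R by (rule mult_R)
  have XiXp: "a * Xi ^ n * X ^ n = a" if "a * E = a" for a n
  proof (induction n)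
    case (Suc n)
    have "a * Xi ^ Suc n * X ^ Suc n = a * Xi ^ n * (Xi * X) * X ^ n"
      by (simp only: power_Suc2[of Xi] power_Suc[of X] mult.assoc)
    also have "\<dots> = a * E * Xi ^ n * X ^ n"
      unfolding XiX using EXi XiE by (metis mult.assoc power_commuting_commutes)
    finally show ?case using Suc that by simp
  qed simp
  have XXip: "a * X ^ n * Xi ^ n = a" if "a * E = a" for a n
    using XiXp[OF that, of n] XXi XiX by (metis mult.assoc power_commuting_commutes)
  have XXip': "X ^ n * (Xi ^ n * a) = a" if "E * a = a" for a n
  proof (induction n)
    case (Suc n)
    have "X ^ Suc n * (Xi ^ Suc n * a) = X ^ n * ((X * Xi) * Xi ^ n * a)"
      by (simp only: power_Suc2[of X] power_Suc[of Xi] mult.assoc)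
    also have "\<dots> = X ^ n * (Xi ^ n * (E * a))"
      unfolding XXi using EXi XiE by (metis mult.assoc power_commuting_commutes)
    finally show ?case using Suc that by simp
  qed simp
  \<comment> \<open>The letters 1 at both ends absorb \<open>E\<close>.\<close>
  have block: "E * ev w = ev w" "ev w * E = ev w" if "block_word j w" for w
    using that
  proof (induction rule: block_word.induct)
    case base
    show "E * ev (replicate j 1 @ [2] @ replicate j 1) = ev (replicate j 1 @ [2] @ replicate j 1)"
      by (simp only: ev_simps) (metis EXj mult.assoc)
    show "ev (replicate j 1 @ [2] @ replicate j 1) * E = ev (replicate j 1 @ [2] @ replicate j 1)"
      by (simp only: ev_simps mult.assoc XjE)
  next
    case (left w)
    show "E * ev (1 # w) = ev (1 # w)"
      by (simp only: ev_simps) (metis EX left.IH(1) mult.assoc)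
    show "ev (1 # w) * E = ev (1 # w)"
      by (simp only: ev_simps mult.assoc left.IH)
  next
    case (right w)
    show "E * ev (w @ [1]) = ev (w @ [1])"
      by (simp only: ev_simps) (metis right.IH(1) mult.assoc)
    show "ev (w @ [1]) * E = ev (w @ [1])"
      by (simp only: ev_simps) (metis EX mult.right_neutral right.IH(2) mult.assoc)
  next
    case (snoc w)
    show "E * ev (w @ replicate j 1 @ [2] @ replicate j 1) = ev (w @ replicate j 1 @ [2] @ replicate j 1)"
      by (simp only: ev_simps) (metis snoc.IH(1) mult.assoc)
    show "ev (w @ replicate j 1 @ [2] @ replicate j 1) * E = ev (w @ replicate j 1 @ [2] @ replicate j 1)"
      by (simp only: ev_simps mult.assoc XjE)
  qed
  \<comment> \<open>Dividing by \<open>X ^ L\<close> makes words of different lengths comparable: a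
    letter 1 appended to a word is cancelled by the extra \<open>Xi\<close>.\<close>
  define G where "G L = {ev w * Xi ^ L |w. block_word j w \<and> length w = L}" for L
  define J where "J L = span (G L)" for L
  have lin: "linear (\<lambda>a. a * b)" "linear (\<lambda>a. b * a)" "linear (\<lambda>a. b * a * c)" for b c :: 'a
    by (simp_all add: linear_iff algebra_simps)
  have ev_R: "ev w \<in> R" if "block_word j w" for w
    unfolding ev_def using AR block_word_set[OF that] block_word_count[OF that]
    by (intro word_R) auto
  have J_R: "J L \<subseteq> R" for L
    unfolding J_def
  proof (rule real_vector.span_minimal[OF _ subspace_R], safe)
    fix a assume "a \<in> G L"
    then obtain w where w: "a = ev w * Xi ^ L" "block_word j w" "length w = L"
      by (auto simp: G_def)
    then have "L > 0" using block_word_count[OF w(2)] by (cases w) auto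
    then show "a \<in> R" using w ev_R XiR by (auto intro: mult_R power_R)
  qed
  have J_Suc: "J L \<subseteq> J (Suc L)" for L
    unfolding J_def
  proof (rule real_vector.span_mono, safe)
    fix a assume "a \<in> G L"
    then obtain w where w: "a = ev w * Xi ^ L" "block_word j w" "length w = L"
      by (auto simp: G_def)
    have "ev (w @ [1]) * Xi ^ Suc L = ev w * (X * Xi) * Xi ^ L"
      by (simp only: ev_simps power_Suc mult.assoc mult_1_right)
    then have "a = ev (w @ [1]) * Xi ^ Suc L"
      by (simp only: XXi block(2)[OF w(2)] w(1))
    then show "a \<in> G (Suc L)"
      using block_word.right[OF w(2)] w(3) unfolding G_def by force
  qed
  have J_mono: "J L \<subseteq> J M" if "L \<le> M" for L M
    using J_Suc that by (rule lift_Suc_mono_le)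
  have J_conj_Suc: "X * a * Xi \<in> J (Suc L)" if "a \<in> J L" for a L
    unfolding J_def
  proof (rule linear_span_subset[OF lin(3) _ that[unfolded J_def]])
    fix a assume "a \<in> G L"
    then obtain w where w: "a = ev w * Xi ^ L" "block_word j w" "length w = L"
      by (auto simp: G_def)
    \<comment> \<open>Prepending a letter 1 amounts to conjugation by \<open>X\<close>.\<close>
    have "X * a * Xi = ev (1 # w) * Xi ^ Suc L"
      by (simp add: w(1) ev_simps mult.assoc power_commutes)
    then show "X * a * Xi \<in> span (G (Suc L))"
      using block_word.left[OF w(2)] w(3) unfolding G_def
      by (intro real_vector.span_base) force
  qed
  \<comment> \<open>\<open>Q k\<close> is the normalized block \<open>T\<close> conjugated by
    \<open>X ^ k\<close>. For \<open>k = L\<close> its factor \<open>X ^ L\<close> cancels the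
    \<open>Xi ^ L\<close> of an element of \<open>G L\<close>, so that multiplying by
    \<open>Q L\<close> appends \<open>T\<close>.\<close>
  define Q where "Q k = X ^ k * ev T * Xi ^ (g + k)" for k
  have Q_Suc: "Q (Suc k) = X * Q k * Xi" for k
    by (simp only: Q_def add_Suc_right power_Suc[of X] power_Suc2[of Xi] mult.assoc)
  have J_snoc: "a * Q L \<in> J (L + g)" if "a \<in> J L" for a L
    unfolding J_def
  proof (rule linear_span_subset[OF lin(1) _ that[unfolded J_def]])
    fix a assume "a \<in> G L"
    then obtain w where w: "a = ev w * Xi ^ L" "block_word j w" "length w = L"
      by (auto simp: G_def)
    have "a * Q L = ev w * Xi ^ L * X ^ L * ev T * Xi ^ (L + g)"
      by (simp add: w(1) Q_def mult.assoc add.commute)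
    also have "\<dots> = ev (w @ T) * Xi ^ (L + g)"
      by (simp add: XiXp[OF block(2)[OF w(2)]] ev_simps)
    finally show "a * Q L \<in> span (G (L + g))"
      using block_word.snoc[OF w(2)] w(3) T(2) unfolding G_def T_def
      by (intro real_vector.span_base) force
  qed
  obtain S where S: "finite S" "card S \<le> D" "R \<subseteq> span S" using spanning_R by blast
  \<comment> \<open>The chain is sampled in steps of \<open>g\<close>, so that appending a whole
    block stays within the stationary span. It starts at \<open>g\<close>, so that this span
    contains \<open>Q 0\<close>.\<close>
  have "\<exists>k\<le>card S. J (Suc k * g) = J (Suc (Suc k) * g)"
  proof (rule subspace_chain_stabilizes)
    show "subspace (J (Suc k * g))" for k by (simp add: J_def real_vector.subspace_span)
    show "J (Suc k * g) \<subseteq> J (Suc (Suc k) * g)" for k by (rule J_mono) simp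
    show "J (Suc k * g) \<subseteq> span S" for k using J_R S(3) by blast
  qed (rule S(1))
  then obtain k where k: "k \<le> D" "J (Suc k * g) = J (Suc (Suc k) * g)"
    using S(2) by (meson order_trans)
  define L where "L = Suc k * g"
  define B where "B = J L"
  have Lg: "L + g \<le> N" "g \<le> L"
  proof -
    have "L + g = (k + 2) * g" by (simp add: L_def)
    also have "\<dots> \<le> (D + 2) * g" using k by (intro mult_right_mono) auto
    finally show "L + g \<le> N" using N by (simp add: g_def)
  qed (simp add: L_def)
  have Jg: "J (L + g) = B" using k(2) by (simp add: L_def B_def add.commute)
  \<comment> \<open>Between two equal members the increasing chain is constant; hence conjugation by
    \<open>X\<close> also preserves \<open>B\<close>.\<close>
  have "J (Suc L) \<subseteq> J (L + g)" by (rule J_mono) (simp add: g_def)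
  then have JS: "J (Suc L) = B" using Jg J_Suc[of L] by (auto simp: B_def)
  have sub: "subspace B" by (simp add: B_def J_def real_vector.subspace_span)
  have BR: "B \<subseteq> R" using J_R by (simp add: B_def)
  have "E * a = a \<and> a * E = a" if "a \<in> B" for a
  proof -
    have "subspace {a. E * a = a \<and> a * E = a}"
      by (auto simp: subspace_def algebra_simps)
    moreover have "G L \<subseteq> {a. E * a = a \<and> a * E = a}"
    proof safe
      fix a assume "a \<in> G L"
      then obtain w where w: "a = ev w * Xi ^ L" "block_word j w" "length w = L"
        by (auto simp: G_def)
      show "E * a = a" by (simp only: w(1) mult.assoc[symmetric] block(1)[OF w(2)])
      have "Xi ^ L * E = Xi ^ L"
        using Lg(2) XiE by (cases L) (auto simp: g_def power_Suc2 mult.assoc simp del: power_Suc)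
      then show "a * E = a" by (simp only: w(1) mult.assoc)
    qed
    ultimately show ?thesis
      using that real_vector.span_minimal[of "G L"] unfolding B_def J_def by blast
  qed
  then have EB: "E * a = a" "a * E = a" if "a \<in> B" for a using that by auto
  have conj: "X * a * Xi \<in> B" if "a \<in> B" for a
    using J_conj_Suc[of a L] that JS by (simp add: B_def)
  have conj_inverse: "Xi * (X * a * Xi) * X = a" if "a \<in> B" for a
  proof -
    have "Xi * (X * a * Xi) * X = (Xi * X) * a * (Xi * X)" by (simp only: mult.assoc)
    then show ?thesis by (simp only: XiX EB[OF that])
  qed
  have conj_surj: "(\<lambda>a. X * a * Xi) ` B = B"
  proof (rule linear_inj_on_subspace_surj[OF lin(3) sub _ S(1)])
    show "B \<subseteq> span S" using BR S(3) by blast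
    show "inj_on (\<lambda>a. X * a * Xi) B" by (rule inj_on_inverseI) (rule conj_inverse)
  qed (use conj in blast)
  have conj': "Xi * a * X \<in> B" if "a \<in> B" for a
  proof -
    from that obtain b where "b \<in> B" "a = X * b * Xi" by (subst (asm) conj_surj[symmetric]) (rule imageE)
    then show ?thesis using conj_inverse by simp
  qed
  have XB: "X ^ n * a * Xi ^ n \<in> B" if "a \<in> B" for a n
  proof (induction n)
    case (Suc n)
    have "X ^ Suc n * a * Xi ^ Suc n = X * (X ^ n * a * Xi ^ n) * Xi"
      by (simp only: power_Suc[of X] power_Suc2[of Xi] mult.assoc)
    then show ?case using conj[OF Suc] by simp
  qed (simp add: that)
  have XiB: "Xi ^ n * a * X ^ n \<in> B" if "a \<in> B" for a n
  proof (induction n)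
    case (Suc n)
    have "Xi ^ Suc n * a * X ^ Suc n = Xi * (Xi ^ n * a * X ^ n) * X"
      by (simp only: power_Suc[of Xi] power_Suc2[of X] mult.assoc)
    then show ?case using conj'[OF Suc] by simp
  qed (simp add: that)
  have BQ: "a * Q 0 \<in> B" if "a \<in> B" for a
  proof -
    \<comment> \<open>Descending induction from \<open>Q L\<close> to \<open>Q 0\<close>:
      conjugating by \<open>Xi\<close> lowers the index, and \<open>B\<close> is stable under
      it.\<close>
    have "\<forall>a\<in>B. a * Q (L - n) \<in> B" if "n \<le> L" for n
      using that
    proof (induction n)
      case 0
      then show ?case using J_snoc[of _ L] Jg by (simp add: B_def)
    next
      case (Suc n)
      show ?case
      proof
        fix a assume a: "a \<in> B"
        have QS: "Q (L - n) = X * Q (L - Suc n) * Xi"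
          using Suc.prems Q_Suc[of "L - Suc n"] by (simp add: Suc_diff_Suc)
        have "Xi * (X * a * Xi * Q (L - n)) * X = (Xi * X) * a * (Xi * X) * Q (L - Suc n) * (Xi * X)"
          by (simp only: QS mult.assoc)
        also have "\<dots> = a * Q (L - Suc n) * E"
          by (simp only: XiX EB[OF a])
        also have "\<dots> = a * Q (L - Suc n)"
        proof -
          have "Xi ^ (g + i) * E = Xi ^ (g + i)" for i
            using XiE by (simp add: g_def power_Suc2 mult.assoc del: power_Suc)
          then show ?thesis by (simp add: Q_def mult.assoc)
        qed
        finally show "a * Q (L - Suc n) \<in> B"
          using conj'[of "X * a * Xi * Q (L - n)"] Suc.IH Suc.prems conj[OF a] by auto
      qed
    qed
    from this[of L] that show ?thesis by auto
  qed
  \<comment> \<open>\<open>B\<close> absorbs a block word on the right, up to the power of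
    \<open>X\<close> that normalizes it. The induction follows the construction of the word, so
    words of any length are covered.\<close>
  have block_B: "\<exists>a'\<in>B. a * ev w = a' * X ^ length w" if "block_word j w" "a \<in> B" for a w
    using that
  proof (induction arbitrary: a rule: block_word.induct)
    case base
    have "a * ev T = a * Q 0 * X ^ g"
      using XiXp[OF block(2)[OF T(1)], of g] by (simp add: Q_def mult.assoc)
    then show ?case using BQ[OF base] T unfolding T_def by auto
  next
    case (left w)
    obtain b where b: "b \<in> B" "Xi * a * X * ev w = b * X ^ length w"
      using left.IH[OF conj'[OF left.prems]] by blast
    have "a * ev (1 # w) = (X * Xi) * a * (X * ev w)"
      by (simp only: XXi EB(1)[OF left.prems] ev_simps)
    also have "\<dots> = X * (Xi * a * X * ev w)"
      by (simp only: mult.assoc)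
    also have "\<dots> = X * (b * (Xi * X) * X ^ length w)"
      by (simp only: b(2) XiX EB(2)[OF b(1)])
    also have "\<dots> = (X * b * Xi) * X ^ length (1 # w)"
      by (simp add: mult.assoc)
    finally show ?case using conj[OF b(1)] by blast
  next
    case (right w)
    then obtain b where b: "b \<in> B" "a * ev w = b * X ^ length w" by blast
    have "a * ev (w @ [1]) = b * X ^ length w * X"
      unfolding b(2)[symmetric] by (simp only: ev_simps mult.assoc mult_1_right)
    also have "\<dots> = b * X ^ length (w @ [1])" by (simp add: mult.assoc power_commutes)
    finally show ?case using b(1) by blast
  next
    case (snoc w)
    define l where "l = length w"
    obtain b where b: "b \<in> B" "a * ev w = b * X ^ l" using snoc l_def by blast
    \<comment> \<open>\<open>b'\<close> is \<open>b\<close> after moving \<open>X ^ l\<close> to its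
      left, so that \<open>BQ\<close> applies next to the new block; conjugating by
      \<open>X ^ l\<close> afterwards restores the required form.\<close>
    define b' where "b' = Xi ^ l * b * X ^ l"
    have b': "b' * Q 0 \<in> B"
      unfolding b'_def by (rule BQ[OF XiB[OF b(1)]])
    have b'_eq: "b * X ^ l = X ^ l * b'"
      unfolding b'_def using XXip'[OF EB(1)[OF b(1)], of l] by (simp add: mult.assoc[symmetric])
    have "a * ev (w @ T) = X ^ l * (b' * ev T)"
      by (simp only: ev_simps mult.assoc[symmetric] b(2) b'_eq)
    also have "\<dots> = X ^ l * (b' * Q 0) * X ^ g"
      using XiXp[OF block(2)[OF T(1)], of g] by (simp add: Q_def mult.assoc)
    also have "\<dots> = (X ^ l * (b' * Q 0) * Xi ^ l) * X ^ l * X ^ g"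
    proof -
      have "X ^ l * (b' * Q 0) * E = X ^ l * (b' * Q 0)"
        using EB(2)[OF b'] by (simp add: mult.assoc)
      from XiXp[OF this, of l] show ?thesis by simp
    qed
    also have "\<dots> = (X ^ l * (b' * Q 0) * Xi ^ l) * X ^ length (w @ T)"
      by (simp add: l_def T mult.assoc power_add)
    finally show ?case using XB[OF b', of l] unfolding T_def by blast
  qed
  have mult_B: "a * b \<in> B" if a: "a \<in> B" and b: "b \<in> B" for a b
  proof -
    have "a * b \<in> span (G L)"
    proof (rule linear_span_subset[OF lin(2) _ b[unfolded B_def J_def]])
      fix b assume "b \<in> G L"
      then obtain w where w: "b = ev w * Xi ^ L" "block_word j w" "length w = L"
        by (auto simp: G_def)
      obtain a' where a': "a' \<in> B" "a * ev w = a' * X ^ L" using block_B[OF w(2) a] w(3) by blast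
      have "a * b = a' * X ^ L * Xi ^ L" using w(1) a'(2) by (simp add: mult.assoc[symmetric])
      also have "\<dots> = a'" using XXip EB(2)[OF a'(1)] by blast
      finally show "a * b \<in> span (G L)" using a' by (simp add: B_def J_def)
    qed
    then show ?thesis by (simp add: B_def J_def)
  qed
  have "Q 0 \<in> J g"
    unfolding J_def Q_def G_def using T by (intro real_vector.span_base) auto
  then have "Q 0 \<in> B" using J_mono[OF Lg(2)] by (auto simp: B_def)
  then have "X ^ L * Q 0 * Xi ^ L \<in> B" by (rule XB)
  then have QL: "Q L \<in> B" by (simp add: Q_def mult.assoc power_add)
  have N0: "N > 0" using Lg by (simp add: g_def)
  \<comment> \<open>For \<open>b = 1\<close> this is the product of a word of length
    \<open>N\<close> with a single 2: \<open>L\<close> letters 1, the block \<open>T\<close>, and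
    letters 1 to fill up.\<close>
  have QN: "b * Q L * X ^ N = b * X ^ L * ev (T @ replicate (N - (g + L)) 1)" for b
  proof -
    have "X ^ N = X ^ (g + L) * X ^ (N - (g + L))"
      using Lg by (simp add: add.commute flip: power_add)
    then have "b * Q L * X ^ N = b * X ^ L * (ev T * Xi ^ (g + L) * X ^ (g + L)) * X ^ (N - (g + L))"
      by (simp add: Q_def mult.assoc)
    then show ?thesis by (simp only: XiXp[OF block(2)[OF T(1)]] ev_simps) (simp only: mult.assoc)
  qed
  \<comment> \<open>Here \<open>u\<close> is \<open>X ^ N\<close>. Conjugation by it preserves
    \<open>B\<close> in both directions, and by cyclicity the two directions are adjoint.\<close>
  have "\<exists>p\<in>B. tr (Q L * X ^ N) = tr (p * Q L * X ^ N)"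
  proof (rule tr_mult_normalizing_eq[OF sub BR mult_B power_R[OF XR N0], where
        f = "\<lambda>a. Xi ^ N * a * X ^ N" and g = "\<lambda>a. X ^ N * a * Xi ^ N"])
    show "a * X ^ N = X ^ N * (Xi ^ N * a * X ^ N)" if "a \<in> B" for a
      using XXip'[OF EB(1)[OF that], of N] by (simp add: mult.assoc[symmetric])
    show "tr (Xi ^ N * a * X ^ N * b) = tr (a * (X ^ N * b * Xi ^ N))" if "a \<in> B" "b \<in> B" for a b
    proof -
      have "Xi ^ N \<in> R" "a * X ^ N * b \<in> R"
        using that BR XR XiR N0 by (auto intro!: mult_R power_R)
      from tr_commute[OF this] show ?thesis by (simp add: mult.assoc)
    qed
  qed (use XB XiB QL in auto)
  then obtain p where p: "p \<in> B" "tr (Q L * X ^ N) = tr (p * Q L * X ^ N)" by blast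
  have "linear (\<lambda>b. tr (b * Q L * X ^ N))"
    using linear_tr by (simp add: linear_iff algebra_simps)
  \<comment> \<open>A generator \<open>b\<close> puts a word with at least one 2 in front of
    \<open>T\<close>, so the whole word of length \<open>N\<close> has two of them.\<close>
  moreover have "tr (b * Q L * X ^ N) = 0" if "b \<in> G L" for b
  proof -
    obtain w where w: "b = ev w * Xi ^ L" "block_word j w" "length w = L"
      using \<open>b \<in> G L\<close> by (auto simp: G_def)
    have "b * Q L * X ^ N = ev (w @ T @ replicate (N - (g + L)) 1)"
      unfolding QN w(1) XiXp[OF block(2)[OF w(2)]] by (simp add: ev_simps)
    moreover have "tr \<dots> = 0"
      unfolding ev_def
      using Lg w(3) T block_word_count[OF w(2)] block_word_count[OF T(1)]
        block_word_set[OF w(2)] block_word_set[OF T(1)]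
      by (intro vanish) auto
    ultimately show ?thesis by simp
  qed
  ultimately have "tr (p * Q L * X ^ N) = 0"
    using p(1) real_vector.linear_eq_0_on_span[of "\<lambda>b. tr (b * Q L * X ^ N)" "G L" p]
    by (simp add: B_def J_def)
  then have "tr (Q L * X ^ N) = 0" using p(2) by simp
  then have "tr (ev (replicate L 1 @ T @ replicate (N - (g + L)) 1)) = 0"
    using QN[of 1] by (simp add: ev_simps)
  then show ?thesis
    unfolding ev_def
    by (intro exI[of _ "replicate L 1 @ T @ replicate (N - (g + L)) 1"])
      (use Lg T in \<open>auto simp: T_def count_list_append\<close>)
qed

end

section \<open>Matrices\<close>

text \<open>Twice the real parts are the power sums of the numbers \<open>c i\<close> together with
  their conjugates. A polynomial that vanishes at all of these numbers except \<open>c l\<close>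
  turns them into the multiplicity of \<open>c l\<close> times a nonzero value.\<close>

lemma Re_power_sums_eq_0:
  fixes c :: "nat \<Rightarrow> complex"
  assumes sums: "\<And>k. k \<ge> 2 \<Longrightarrow> Re (\<Sum>i<m. c i ^ k) = 0" and "l < m"
  shows "c l = 0"
proof (rule ccontr)
  assume nz: "c l \<noteq> 0"
  define Z where "Z = c ` {..<m} \<union> cnj ` c ` {..<m} - {c l}"
  \<comment> \<open>The factor \<open>monom 1 2\<close> removes the coefficients 0 and 1, for which
    no power sum is given; it is nonzero at \<open>c l\<close>.\<close>
  define q where "q = monom 1 2 * (\<Prod>z\<in>Z. [:- z, 1:])"
  have finZ: "finite Z" by (simp add: Z_def)
  have poly_q: "poly q x = x ^ 2 * (\<Prod>z\<in>Z. x - z)" for x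
    by (simp add: q_def poly_monom poly_prod)
  have q0: "coeff q k = 0" if "k < 2" for k
    using that by (simp add: q_def coeff_monom_mult)
  have q_nz: "poly q (c l) \<noteq> 0"
    using nz finZ by (auto simp: poly_q Z_def)
  have q_c: "poly q (c i) = (if c i = c l then poly q (c l) else 0)" if "i < m" for i
    using finZ that by (auto simp: poly_q Z_def)
  have q_cnj: "poly q (cnj (c i)) = (if cnj (c i) = c l then poly q (c l) else 0)" if "i < m" for i
    using finZ that by (auto simp: poly_q Z_def)
  have pw: "coeff q k * (\<Sum>i<m. c i ^ k + cnj (c i) ^ k) = 0" for k
  proof (cases "k < 2")
    case False
    have "(\<Sum>i<m. c i ^ k + cnj (c i) ^ k) = of_real (2 * Re (\<Sum>i<m. c i ^ k))"
      by (simp add: complex_add_cnj sum_distrib_left flip: complex_cnj_power)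
    then show ?thesis
      using sums[of k] False by (simp only: not_less mult_zero_right of_real_0)
  qed (simp add: q0)
  define n where "n = card {i\<in>{..<m}. c i = c l} + card {i\<in>{..<m}. cnj (c i) = c l}"
  have "0 = (\<Sum>k\<le>degree q. coeff q k * (\<Sum>i<m. c i ^ k + cnj (c i) ^ k))"
    by (simp only: pw sum.neutral_const)
  also have "\<dots> = (\<Sum>i<m. poly q (c i) + poly q (cnj (c i)))"
    unfolding poly_altdef sum_distrib_left
    by (subst sum.swap) (simp add: sum.distrib algebra_simps)
  also have "\<dots> = (\<Sum>i<m. (if c i = c l then poly q (c l) else 0)
      + (if cnj (c i) = c l then poly q (c l) else 0))"
    by (intro sum.cong refl) (simp add: q_c q_cnj)
  also have "\<dots> = of_nat n * poly q (c l)"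
    by (simp add: sum.distrib n_def algebra_simps flip: sum.inter_filter)
  finally have "n = 0" using q_nz by simp
  then show False using assms(2) by (auto simp: n_def)
qed

lemma upper_triangular_mult:
  fixes B C :: "'a::comm_ring_1 mat"
  assumes "B \<in> carrier_mat m m" "C \<in> carrier_mat m m" "upper_triangular B" "upper_triangular C"
  shows "upper_triangular (B * C)" "\<And>i. i < m \<Longrightarrow> (B * C) $$ (i, i) = B $$ (i, i) * C $$ (i, i)"
proof -
  have *: "(B * C) $$ (i, j) = (if i = j then B $$ (i, i) * C $$ (i, i) else 0)"
    if "j \<le> i" "i < m" for i j
  proof -
    have "(B * C) $$ (i, j) = (\<Sum>k\<in>{0..<m}. B $$ (i, k) * C $$ (k, j))"
      using assms(1,2) that by (simp add: scalar_prod_def)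
    also have "\<dots> = (\<Sum>k\<in>{0..<m}. if k = i then (if i = j then B $$ (i, i) * C $$ (i, i) else 0) else 0)"
    proof (rule sum.cong)
      fix k assume k: "k \<in> {0..<m}"
      consider "k < i" | "k = i" | "k > i" by linarith
      then show "B $$ (i, k) * C $$ (k, j)
          = (if k = i then (if i = j then B $$ (i, i) * C $$ (i, i) else 0) else 0)"
        by cases (use assms that k in \<open>auto simp: upper_triangularD\<close>)
    qed simp
    finally show ?thesis using that by simp
  qed
  show "upper_triangular (B * C)"
    using assms(1,2) * by (intro upper_triangularI) auto
  show "(B * C) $$ (i, i) = B $$ (i, i) * C $$ (i, i)" if "i < m" for i
    using *[of i i] that by simp
qed

lemma upper_triangular_power:
  fixes B :: "'a::comm_ring_1 mat"
  assumes "B \<in> carrier_mat m m" "upper_triangular B"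
  shows "upper_triangular (B ^\<^sub>m k) \<and> (\<forall>i<m. (B ^\<^sub>m k) $$ (i, i) = (B $$ (i, i)) ^ k)"
proof (induction k)
  case 0
  then show ?case using assms(1) by auto
next
  case (Suc k)
  then show ?case
    using upper_triangular_mult[OF _ assms(1) _ assms(2), of "B ^\<^sub>m k"] assms(1)
    by (auto simp: mult.commute)
qed

text \<open>The matrices of all sizes are embedded into one type that is an instance of
  \<^class>\<open>real_algebra_1\<close>; the trace is replaced by its real part, as only the real vector space structure
  is used.\<close>

typedef linop = "{f :: (nat \<Rightarrow> complex) \<Rightarrow> nat \<Rightarrow> complex.
    \<forall>c x y. f (\<lambda>i. c * x i + y i) = (\<lambda>i. c * f x i + f y i)}"
  by (rule exI[of _ id]) simp

setup_lifting type_definition_linop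

lemma linop_linear: "Rep_linop f (\<lambda>i. c * x i + y i) = (\<lambda>i. c * Rep_linop f x i + Rep_linop f y i)"
  using Rep_linop[of f] by blast

lemma linop_zero: "Rep_linop f (\<lambda>i. 0) = (\<lambda>i. 0)"
  using linop_linear[of f 1 "\<lambda>i. 0" "\<lambda>i. 0"] by (simp add: fun_eq_iff)

lemma linop_add: "Rep_linop f (\<lambda>i. x i + y i) = (\<lambda>i. Rep_linop f x i + Rep_linop f y i)"
  using linop_linear[of f 1 x y] by simp

lemma linop_mult: "Rep_linop f (\<lambda>i. c * x i) = (\<lambda>i. c * Rep_linop f x i)"
  using linop_linear[of f c x "\<lambda>i. 0"] by (simp add: linop_zero)

instantiation linop :: real_algebra_1
begin

lift_definition zero_linop :: linop is "\<lambda>x i. 0" by simp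
lift_definition one_linop :: linop is "\<lambda>x. x" by simp
lift_definition plus_linop :: "linop \<Rightarrow> linop \<Rightarrow> linop" is "\<lambda>f g x i. f x i + g x i"
  by (simp add: algebra_simps)
lift_definition minus_linop :: "linop \<Rightarrow> linop \<Rightarrow> linop" is "\<lambda>f g x i. f x i - g x i"
  by (simp add: algebra_simps)
lift_definition uminus_linop :: "linop \<Rightarrow> linop" is "\<lambda>f x i. - f x i"
  by (simp add: algebra_simps)
lift_definition times_linop :: "linop \<Rightarrow> linop \<Rightarrow> linop" is "\<lambda>f g x. f (g x)" by simp
lift_definition scaleR_linop :: "real \<Rightarrow> linop \<Rightarrow> linop" is "\<lambda>r f x i. of_real r * f x i"
  by (simp add: algebra_simps)

instance
proof
  fix f g h :: linop and r s :: real
  show "f + g + h = f + (g + h)" "f + g = g + f" "0 + f = f" "- f + f = 0" "f - g = f + - g"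
    by (transfer; simp add: fun_eq_iff)+
  show "r *\<^sub>R (f + g) = r *\<^sub>R f + r *\<^sub>R g" "(r + s) *\<^sub>R f = r *\<^sub>R f + s *\<^sub>R f"
    "r *\<^sub>R s *\<^sub>R f = (r * s) *\<^sub>R f" "1 *\<^sub>R f = f"
    by (transfer; simp add: fun_eq_iff algebra_simps)+
  show "f * g * h = f * (g * h)" "1 * f = f" "f * 1 = f" "(f + g) * h = f * h + g * h"
    "r *\<^sub>R f * g = r *\<^sub>R (f * g)"
    by (transfer; simp add: fun_eq_iff)+
  show "f * (g + h) = f * g + f * h"
    by (simp add: Rep_linop_inject[symmetric] times_linop.rep_eq plus_linop.rep_eq fun_eq_iff linop_add)
  show "f * r *\<^sub>R g = r *\<^sub>R (f * g)"
    by (simp add: Rep_linop_inject[symmetric] times_linop.rep_eq scaleR_linop.rep_eq fun_eq_iff linop_mult)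
  show "(0::linop) \<noteq> 1"
  proof
    assume "(0::linop) = 1"
    then have "Rep_linop 0 (\<lambda>_. 1) 0 = Rep_linop 1 (\<lambda>_. 1) 0" by simp
    then show False by (simp add: zero_linop.rep_eq one_linop.rep_eq)
  qed
qed

end

lemma linop_eqI: "(\<And>x i. Rep_linop f x i = Rep_linop g x i) \<Longrightarrow> f = g"
  by (simp add: Rep_linop_inject[symmetric] fun_eq_iff)

text \<open>Complex scalars as operators: eigenvalues are complex, while the type carries only a
  real scalar multiplication.\<close>

lift_definition linop_scal :: "complex \<Rightarrow> linop" is "\<lambda>c x i. c * x i"
  by (simp add: algebra_simps)

lemma linop_scal_commute: "linop_scal c * f = f * linop_scal c"
  by (rule linop_eqI) (simp add: times_linop.rep_eq linop_scal.rep_eq linop_mult)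

lemma linop_scal_simps: "linop_scal 0 = 0" "linop_scal c * linop_scal c' = linop_scal (c * c')"
  "linop_scal 1 = 1" "linop_scal (- c) = - linop_scal c"
  by (transfer; simp add: fun_eq_iff)+

section \<open>Matrices as operators\<close>

text \<open>Coordinates from \<open>m\<close> on are sent to 0. The unit matrix thus becomes a
  projection instead of \<open>1\<close>.\<close>

lift_definition mat_op :: "nat \<Rightarrow> complex mat \<Rightarrow> linop" is
  "\<lambda>m A x i. if i < m then \<Sum>j<m. A $$ (i, j) * x j else 0"
  by (auto simp: fun_eq_iff algebra_simps sum.distrib sum_distrib_left)

lift_definition op_trace :: "nat \<Rightarrow> linop \<Rightarrow> real" is
  "\<lambda>m f. Re (\<Sum>i<m. f (\<lambda>j. if j = i then 1 else 0) i)" .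

lemma linear_op_trace: "linear (op_trace m)"
  by (rule linearI; transfer) (simp_all add: sum.distrib sum_distrib_left algebra_simps)

lemma if_zero_mult:
  fixes y z :: complex
  shows "(if P then z else 0) * y = (if P then z * y else 0)"
    and "y * (if P then z else 0) = (if P then y * z else 0)"
  by simp_all

lemma mat_op_mult:
  assumes "A \<in> carrier_mat m m" "B \<in> carrier_mat m m"
  shows "mat_op m (A * B) = mat_op m A * mat_op m B"
proof (rule linop_eqI)
  fix x i
  show "Rep_linop (mat_op m (A * B)) x i = Rep_linop (mat_op m A * mat_op m B) x i"
  proof (cases "i < m")
    case True
    have "(\<Sum>j<m. (\<Sum>k<m. A $$ (i, k) * B $$ (k, j)) * x j)
        = (\<Sum>k<m. A $$ (i, k) * (\<Sum>j<m. B $$ (k, j) * x j))"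
      unfolding sum_distrib_left sum_distrib_right by (subst sum.swap) (simp add: mult.assoc)
    then show ?thesis
      using True assms
      by (simp add: mat_op.rep_eq times_linop.rep_eq scalar_prod_def atLeast0LessThan)
  qed (simp add: mat_op.rep_eq times_linop.rep_eq)
qed

lemma mat_op_linear:
  assumes "A \<in> carrier_mat m m" "B \<in> carrier_mat m m"
  shows "mat_op m (A + B) = mat_op m A + mat_op m B"
    and "mat_op m (of_real r \<cdot>\<^sub>m A) = r *\<^sub>R mat_op m A"
    and "mat_op m (0\<^sub>m m m) = 0"
  using assms
  by (auto intro!: linop_eqI simp: mat_op.rep_eq plus_linop.rep_eq scaleR_linop.rep_eq
      zero_linop.rep_eq sum.distrib sum_distrib_left algebra_simps)

lemma mat_op_entry:
  assumes "i < m" "j < m"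
  shows "Rep_linop (mat_op m A) (\<lambda>k. if k = j then 1 else 0) i = A $$ (i, j)"
  using assms by (simp add: mat_op.rep_eq if_distrib cong: if_cong)

lemma op_trace_mat_op: "op_trace m (mat_op m A) = Re (\<Sum>i<m. A $$ (i, i))"
  by (simp add: op_trace.rep_eq mat_op_entry)

lemma mat_op_one:
  assumes "A \<in> carrier_mat m m"
  shows "mat_op m (1\<^sub>m m) * mat_op m A = mat_op m A" "mat_op m A * mat_op m (1\<^sub>m m) = mat_op m A"
  using assms by (simp_all flip: mat_op_mult)

text \<open>The projection on the right accounts for \<open>k = 0\<close>, where the power of the
  operator is the \<open>1\<close> of the type.\<close>

lemma mat_op_power:
  assumes "A \<in> carrier_mat m m"
  shows "mat_op m (A ^\<^sub>m k) = mat_op m A ^ k * mat_op m (1\<^sub>m m)"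
proof (induction k)
  case 0
  then show ?case using assms by simp
next
  case (Suc k)
  have "mat_op m (A ^\<^sub>m Suc k) = mat_op m A ^ k * (mat_op m (1\<^sub>m m) * mat_op m A)"
    using Suc assms by (simp add: mat_op_mult[OF pow_carrier_mat[OF assms]] mult.assoc)
  also have "\<dots> = mat_op m A ^ k * (mat_op m A * mat_op m (1\<^sub>m m))"
    using mat_op_one[OF assms] by simp
  finally show ?case by (simp add: power_Suc2 mult.assoc del: power_Suc)
qed

lemma op_trace_commute:
  assumes "A \<in> carrier_mat m m" "B \<in> carrier_mat m m"
  shows "op_trace m (mat_op m A * mat_op m B) = op_trace m (mat_op m B * mat_op m A)"
proof -
  have "(\<Sum>i<m. \<Sum>k<m. A $$ (i, k) * B $$ (k, i)) = (\<Sum>i<m. \<Sum>k<m. B $$ (i, k) * A $$ (k, i))"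
    by (subst sum.swap) (simp add: mult.commute)
  then show ?thesis
    using assms
    by (simp add: op_trace_mat_op scalar_prod_def atLeast0LessThan flip: mat_op_mult)
qed

section \<open>Characteristic polynomials and quasi-inverses\<close>

text \<open>With the eigenvalues as \<open>c\<close> and \<open>k = m\<close>, this is the
  characteristic polynomial evaluated at \<open>b\<close>.\<close>

primrec shifted_prod :: "linop \<Rightarrow> (nat \<Rightarrow> complex) \<Rightarrow> nat \<Rightarrow> linop" where
  "shifted_prod b c 0 = 1"
| "shifted_prod b c (Suc k) = shifted_prod b c k * (b - linop_scal (c k))"

text \<open>The factor with index \<open>k\<close> maps vectors supported on the first
  \<open>k + 1\<close> coordinates to vectors supported on the first \<open>k\<close>; it is applied
  before the factors of smaller index.\<close>

lemma shifted_prod_upper_triangular: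
  assumes B: "B \<in> carrier_mat m m" "upper_triangular B"
    and k: "k \<le> m" "\<And>i. i \<ge> k \<Longrightarrow> x i = 0"
  shows "Rep_linop (shifted_prod (mat_op m B) (\<lambda>i. B $$ (i, i)) k) x = (\<lambda>i. 0)"
  using k
proof (induction k arbitrary: x)
  case 0
  then show ?case by (simp add: one_linop.rep_eq fun_eq_iff)
next
  case (Suc k)
  have "Rep_linop (mat_op m B - linop_scal (B $$ (k, k))) x i = 0" if i: "i \<ge> k" for i
  proof (cases "i < m")
    case True
    have "(\<Sum>j<m. B $$ (i, j) * x j) = (\<Sum>j<m. if j = k then B $$ (i, k) * x k else 0)"
    proof (rule sum.cong)
      fix j assume "j \<in> {..<m}"
      consider "j < k" | "j = k" | "j > k" by linarith
      then show "B $$ (i, j) * x j = (if j = k then B $$ (i, k) * x k else 0)"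
        by cases (use i True B Suc.prems(2) in \<open>auto simp: upper_triangularD\<close>)
    qed simp
    also have "\<dots> = B $$ (k, k) * x i"
    proof (cases "i = k")
      case False
      then have "B $$ (i, k) = 0" "x i = 0"
        using i True B Suc.prems(2) by (auto simp: upper_triangularD)
      then show ?thesis by simp
    qed (use Suc.prems(1) in simp)
    finally show ?thesis
      using True by (simp add: minus_linop.rep_eq mat_op.rep_eq linop_scal.rep_eq)
  next
    case False
    then show ?thesis
      using Suc.prems by (simp add: minus_linop.rep_eq mat_op.rep_eq linop_scal.rep_eq)
  qed
  then show ?case
    using Suc.IH[of "Rep_linop (mat_op m B - linop_scal (B $$ (k, k))) x"] Suc.prems
    by (simp add: times_linop.rep_eq)
qed

lemma shifted_prod_intertwine:
  assumes "a * p = p * b"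
  shows "shifted_prod a c k * p = p * shifted_prod b c k"
proof (induction k)
  case (Suc k)
  have "(a - linop_scal (c k)) * p = p * (b - linop_scal (c k))"
    using assms by (simp add: algebra_simps linop_scal_commute[of "c k" p])
  then have "shifted_prod a c (Suc k) * p = shifted_prod a c k * p * (b - linop_scal (c k))"
    by (simp add: mult.assoc)
  then show ?case using Suc by (simp add: mult.assoc)
qed simp

text \<open>The second property is the Cayley--Hamilton theorem.\<close>

lemma eigenvalues_exist:
  assumes A: "A \<in> carrier_mat m m"
  defines "a \<equiv> mat_op m A" and "e \<equiv> mat_op m (1\<^sub>m m)"
  shows "\<exists>c. (\<forall>k>0. op_trace m (a ^ k) = Re (\<Sum>i<m. c i ^ k))
    \<and> shifted_prod a c m * e = 0 \<and> (\<forall>n. a ^ n = 0 \<longrightarrow> (\<forall>i<m. c i = 0))"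
proof -
  obtain es where "char_poly A = (\<Prod>a\<leftarrow>es. [:- a, 1:])"
    using char_poly_factorized[OF A] by blast
  from schur_decomposition_exists[OF A this] obtain B where
    B: "B \<in> carrier_mat m m" "upper_triangular B" "similar_mat A B" by blast
  then obtain P Q where PQ: "P \<in> carrier_mat m m" "Q \<in> carrier_mat m m"
    "P * Q = 1\<^sub>m m" "Q * P = 1\<^sub>m m" "A = P * B * Q"
    using similar_mat_witD[of m A B] A unfolding similar_mat_def by (metis carrier_matD(1))
  \<comment> \<open>As operators, \<open>p\<close> and \<open>q\<close> are mutually inverse only up
    to the projection \<open>e\<close>, so the similarity is carried through products with
    \<open>e\<close>.\<close>
  define p q b where "p = mat_op m P" and "q = mat_op m Q" and "b = mat_op m B"
  have pq: "p * q = e" and qp: "q * p = e" and a: "a = p * b * q"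
    using PQ B(1) by (simp_all add: p_def q_def b_def e_def a_def flip: mat_op_mult)
  have eb: "e * b = b" "b * e = b" "q * e = q" "e * q = q" "e * p = p" "p * e = p"
    using mat_op_one PQ B by (simp_all add: e_def p_def b_def q_def)
  have ap: "a * p = p * b" by (simp add: a mult.assoc qp eb)
  have ak: "a ^ k * p = p * b ^ k" for k
  proof (induction k)
    case (Suc k)
    have "a ^ Suc k * p = a * (a ^ k * p)" by (simp add: mult.assoc)
    also have "\<dots> = p * b ^ Suc k" by (simp add: Suc ap mult.assoc[symmetric])
    finally show ?case .
  qed simp
  have ae: "a ^ k * e = p * b ^ k * q" for k
    by (simp add: pq[symmetric] mult.assoc[symmetric] ak)
  have ae': "a ^ k * e = a ^ k" if "k > 0" for k
    using that mat_op_one(2)[OF A] by (cases k) (simp_all add: e_def a_def power_Suc2 mult.assoc del: power_Suc)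
  define c where "c i = B $$ (i, i)" for i
  have bk: "b ^ k * e = mat_op m (B ^\<^sub>m k)" for k
    by (simp add: b_def e_def mat_op_power[OF B(1)])
  have "op_trace m (a ^ k) = Re (\<Sum>i<m. c i ^ k)" if k: "k > 0" for k
  proof -
    have BQ: "B ^\<^sub>m k * Q \<in> carrier_mat m m"
      by (rule mult_carrier_mat[OF pow_carrier_mat[OF B(1)] PQ(2)])
    have "b ^ k * q = mat_op m (B ^\<^sub>m k * Q)"
      using B(1) PQ(2) by (simp add: mat_op_mult[of _ m] bk[symmetric] mult.assoc eb flip: q_def)
    then have "op_trace m (p * (b ^ k * q)) = op_trace m (b ^ k * q * p)"
      using op_trace_commute[OF PQ(1) BQ] by (simp add: p_def)
    also have "\<dots> = op_trace m (mat_op m (B ^\<^sub>m k))" by (simp add: mult.assoc qp bk)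
    also have "\<dots> = Re (\<Sum>i<m. c i ^ k)"
      using upper_triangular_power[OF B(1,2), of k] by (simp add: op_trace_mat_op c_def)
    finally show ?thesis using ae[of k] ae'[OF k] by (simp add: mult.assoc)
  qed
  moreover have "shifted_prod a c m * e = 0"
  proof -
    have "shifted_prod b c m * e = 0"
    proof (rule linop_eqI)
      fix x i
      have "Rep_linop (shifted_prod b c m) (Rep_linop e x) = (\<lambda>i. 0)"
        unfolding b_def c_def
        by (rule shifted_prod_upper_triangular[OF B(1,2)]) (simp_all add: e_def mat_op.rep_eq)
      then show "Rep_linop (shifted_prod b c m * e) x i = Rep_linop 0 x i"
        by (simp add: times_linop.rep_eq zero_linop.rep_eq)
    qed
    moreover have "shifted_prod a c m * e = p * (shifted_prod b c m * e) * q"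
      by (simp add: pq[symmetric] mult.assoc[symmetric] shifted_prod_intertwine[OF ap])
        (simp add: mult.assoc pq eb)
    ultimately show ?thesis by simp
  qed
  moreover have "c i = 0" if n: "a ^ n = 0" and i: "i < m" for n i
  proof -
    have "mat_op m (B ^\<^sub>m n) = e * b ^ n * e"
      using mat_op_one(1)[of "B ^\<^sub>m n" m] B(1) by (simp add: bk e_def[symmetric] mult.assoc)
    also have "\<dots> = q * (a ^ n * p * e)"
      by (simp only: ak mult.assoc[symmetric] qp)
    also have "\<dots> = 0" by (simp add: n)
    finally have "(B ^\<^sub>m n) $$ (i, i) = 0"
      using mat_op_entry[OF i i, of "B ^\<^sub>m n"] by (simp add: zero_linop.rep_eq)
    then show ?thesis using upper_triangular_power[OF B(1,2), of n] i by (simp add: c_def)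
  qed
  ultimately show ?thesis by blast
qed

text \<open>Where the shifted product vanishes, \<open>b ^ n = b ^ Suc n * r\<close>, so
  \<open>r\<close> inverts \<open>b\<close> on the range of \<open>b ^ n\<close>. Each factor
  \<open>b - c\<close> becomes \<open>b * (1 - b * s)\<close> after multiplication by 1 if
  \<open>c = 0\<close> and by \<open>- b / c\<close> otherwise, with \<open>s\<close> equal to 0 or
  \<open>1 / c\<close>.\<close>

lemma shifted_prod_inverse:
  "\<exists>q r. q * b = b * q \<and> r * b = b * r \<and> q * shifted_prod b c n = b ^ n - b ^ Suc n * r"
proof (induction n)
  case 0
  show ?case by (rule exI[of _ 1], rule exI[of _ 0]) simp
next
  case (Suc n)
  then obtain q r where qr: "q * b = b * q" "r * b = b * r"
    "q * shifted_prod b c n = b ^ n - b ^ Suc n * r" by blast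
  define d where "d = b - linop_scal (c n)"
  have "\<exists>q1 s. q1 * b = b * q1 \<and> q1 * r = r * q1 \<and> q1 * d = b - b * b * linop_scal s"
  proof (cases "c n = 0")
    case True
    then show ?thesis
      by (intro exI[of _ 1] exI[of _ 0]) (simp add: d_def linop_scal_simps)
  next
    case False
    have "linop_scal (- 1 / c n) * b * d = b - b * b * linop_scal (1 / c n)"
    proof -
      have "linop_scal (- 1 / c n) * b * linop_scal (c n)
          = linop_scal (- 1 / c n) * linop_scal (c n) * b"
        by (simp only: mult.assoc linop_scal_commute[of "c n" b])
      also have "\<dots> = - b"
        using False by (simp add: linop_scal_simps)
      finally have "linop_scal (- 1 / c n) * b * linop_scal (c n) = - b" .
      moreover have "linop_scal (- 1 / c n) * b * b = - (linop_scal (1 / c n) * (b * b))"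
        using linop_scal_simps(4)[of "1 / c n"] by (simp add: mult.assoc)
      moreover have "linop_scal (1 / c n) * (b * b) = b * b * linop_scal (1 / c n)"
        by (rule linop_scal_commute)
      ultimately show ?thesis by (simp add: d_def right_diff_distrib)
    qed
    moreover have "linop_scal (- 1 / c n) * b * x = x * (linop_scal (- 1 / c n) * b)"
      if "x * b = b * x" for x
      using that by (metis linop_scal_commute mult.assoc)
    ultimately show ?thesis using qr(2) by metis
  qed
  then obtain q1 s where q1: "q1 * b = b * q1" "q1 * r = r * q1" "q1 * d = b - b * b * linop_scal s"
    by blast
  have bp: "q1 * b ^ k = b ^ k * q1" for k
    using q1(1) by (metis power_commuting_commutes)
  \<comment> \<open>\<open>(1 - b * r) * (1 - b * s) = 1 - b * r'\<close>, as \<open>r\<close>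
    commutes with \<open>b\<close>.\<close>
  define r' where "r' = linop_scal s + r - b * r * linop_scal s"
  have "q1 * q * shifted_prod b c (Suc n) = q1 * (q * shifted_prod b c n) * d"
    by (simp add: d_def mult.assoc)
  also have "\<dots> = q1 * (b ^ n - b ^ Suc n * r) * d"
    by (simp only: qr(3))
  also have "\<dots> = (b ^ n - b ^ Suc n * r) * (q1 * d)"
  proof -
    have "q1 * (b ^ Suc n * r) = b ^ Suc n * r * q1"
      using bp[of "Suc n"] q1(2) by (metis mult.assoc)
    then have "q1 * (b ^ n - b ^ Suc n * r) = (b ^ n - b ^ Suc n * r) * q1"
      using bp[of n] by (simp only: right_diff_distrib left_diff_distrib)
    then show ?thesis by (simp only: mult.assoc)
  qed
  also have "\<dots> = b ^ Suc n - b ^ Suc (Suc n) * r'"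
  proof -
    have "b ^ n * b = b ^ Suc n" "b ^ n * (b * b * linop_scal s) = b ^ Suc (Suc n) * linop_scal s"
      by (simp_all only: power_Suc2 mult.assoc)
    moreover have "b ^ Suc n * r * b = b ^ Suc (Suc n) * r"
      by (simp only: mult.assoc qr(2) power_Suc2[of b "Suc n"])
    moreover have "b ^ Suc n * r * (b * b * linop_scal s) = b ^ Suc (Suc n) * (b * r * linop_scal s)"
    proof -
      have "r * (b * (b * linop_scal s)) = b * (b * (r * linop_scal s))"
        using qr(2) by (metis mult.assoc)
      then show ?thesis by (simp only: mult.assoc power_Suc2[of b "Suc n"])
    qed
    ultimately show ?thesis
      unfolding q1(3) r'_def by (simp only: right_diff_distrib left_diff_distrib distrib_left) simp
  qed
  finally have "q1 * q * shifted_prod b c (Suc n) = b ^ Suc n - b ^ Suc (Suc n) * r'" .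
  moreover have "q1 * q * b = b * (q1 * q)" using q1(1) qr(1) by (metis mult.assoc)
  moreover have "r' * b = b * r'"
  proof -
    have "b * r * linop_scal s * b = b * (b * r * linop_scal s)"
      using qr(2) by (metis linop_scal_commute mult.assoc)
    then show ?thesis
      using qr(2) by (simp add: r'_def linop_scal_commute[of s b] algebra_simps)
  qed
  ultimately show ?case by blast
qed


text \<open>By Cayley--Hamilton the shifted product vanishes on the first \<open>m\<close>
  coordinates, so the \<open>r\<close> of \<open>shifted_prod_inverse\<close> is a quasi-inverse
  there. Compressing it by the projection \<open>e\<close> turns it into a matrix.\<close>

lemma mat_op_quasi_inverse:
  assumes A: "A \<in> carrier_mat m m" and "m > 0"
  shows "\<exists>X'. X' \<in> carrier_mat m m \<and> mat_op m A * mat_op m X' = mat_op m X' * mat_op m A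
    \<and> mat_op m A ^ Suc m * mat_op m X' = mat_op m A ^ m"
proof -
  define a e where "a = mat_op m A" and "e = mat_op m (1\<^sub>m m)"
  have ea: "e * a = a" "a * e = a" using mat_op_one[OF A] by (simp_all add: a_def e_def)
  obtain c where c: "shifted_prod a c m * e = 0"
    using eigenvalues_exist[OF A] by (auto simp: a_def e_def)
  obtain q r where r: "r * a = a * r" "q * shifted_prod a c m = a ^ m - a ^ Suc m * r"
    using shifted_prod_inverse[of a c m] by blast
  have "(a ^ m - a ^ Suc m * r) * e = 0"
    unfolding r(2)[symmetric] mult.assoc c by simp
  then have eq: "a ^ m * e = a ^ Suc m * r * e" by (simp add: algebra_simps)
  have ame: "a ^ k * e = a ^ k" if "k > 0" for k
    using that ea by (cases k) (simp_all add: power_Suc2 mult.assoc del: power_Suc)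
  define X' where "X' = Matrix.mat m m (\<lambda>(i, j). Rep_linop r (\<lambda>k. if k = j then 1 else 0) i)"
  have "mat_op m X' = e * r * e"
  proof (rule linop_eqI)
    fix x i
    \<comment> \<open>\<open>e\<close> turns \<open>x\<close> into a finite combination of unit
      vectors, so linearity determines \<open>r\<close> on it.\<close>
    have fin: "Rep_linop r (\<lambda>k. \<Sum>j<n. x j * (if k = j then 1 else 0)) i
        = (\<Sum>j<n. x j * Rep_linop r (\<lambda>k. if k = j then 1 else 0) i)" for n
      by (induction n) (simp_all add: linop_zero linop_add linop_mult)
    have "(\<lambda>k. \<Sum>j<m. x j * (if k = j then 1 else 0)) = Rep_linop e x"
      by (auto simp: fun_eq_iff e_def mat_op.rep_eq if_zero_mult)
    then show "Rep_linop (mat_op m X') x i = Rep_linop (e * r * e) x i"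
      using fin[of m]
      by (simp add: times_linop.rep_eq mat_op.rep_eq X'_def e_def if_zero_mult mult.commute)
  qed
  moreover have "a * (e * r * e) = e * r * e * a"
  proof -
    have "a * (e * r * e) = (a * e) * r * e" by (simp only: mult.assoc)
    also have "\<dots> = r * (a * e)" by (simp only: ea r(1)[symmetric]) (simp only: mult.assoc ea)
    also have "\<dots> = (e * a) * r" by (simp only: ea r(1))
    also have "\<dots> = e * (r * a)" by (simp only: r(1) mult.assoc)
    also have "\<dots> = e * r * (e * a)" by (simp only: ea mult.assoc)
    also have "\<dots> = e * r * e * a" by (simp only: mult.assoc)
    finally show ?thesis .
  qed
  moreover have "a ^ Suc m * (e * r * e) = a ^ m"
    using eq ame[of "Suc m"] ame[of m] \<open>m > 0\<close> by (simp only: mult.assoc[symmetric])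
  ultimately show ?thesis
    by (intro exI[of _ X']) (simp add: a_def X'_def)
qed

text \<open>Nilpotency and trace are both read off from the eigenvalues. The dimension is counted
  over the reals, hence the factor 2.\<close>

lemma trace_algebra_matrices:
  "trace_algebra (mat_op m ` carrier_mat m m) (op_trace m) (2 * m ^ 2)"
proof (rule trace_algebra.intro)
  show "subspace (mat_op m ` carrier_mat m m)"
    unfolding subspace_def
  proof (intro conjI ballI allI)
    show "0 \<in> mat_op m ` carrier_mat m m"
      using mat_op_linear(3)[of "0\<^sub>m m m" m] by (metis image_eqI zero_carrier_mat)
    show "x + y \<in> mat_op m ` carrier_mat m m"
      if "x \<in> mat_op m ` carrier_mat m m" "y \<in> mat_op m ` carrier_mat m m" for x y
      using that by (auto simp flip: mat_op_linear(1))
    show "r *\<^sub>R x \<in> mat_op m ` carrier_mat m m" if "x \<in> mat_op m ` carrier_mat m m" for r x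
      using that by (auto simp flip: mat_op_linear(2))
  qed
  show "a * b \<in> mat_op m ` carrier_mat m m"
    if "a \<in> mat_op m ` carrier_mat m m" "b \<in> mat_op m ` carrier_mat m m" for a b
    using that by (auto simp flip: mat_op_mult)
  show "op_trace m (a * b) = op_trace m (b * a)"
    if "a \<in> mat_op m ` carrier_mat m m" "b \<in> mat_op m ` carrier_mat m m" for a b
    using that op_trace_commute by blast
  show "linear (op_trace m)" by (rule linear_op_trace)
  show "\<exists>n. a ^ n = 0"
    if "a \<in> mat_op m ` carrier_mat m m" "\<And>k. k \<ge> 2 \<Longrightarrow> op_trace m (a ^ k) = 0" for a
  proof -
    obtain A where A: "A \<in> carrier_mat m m" "a = mat_op m A" using \<open>a \<in> _\<close> by blast
    obtain c where c: "\<And>k. k > 0 \<Longrightarrow> op_trace m (a ^ k) = Re (\<Sum>i<m. c i ^ k)"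
      "shifted_prod a c m * mat_op m (1\<^sub>m m) = 0"
      using eigenvalues_exist[OF A(1)] A(2) by blast
    have "c i = 0" if "i < m" for i
      using Re_power_sums_eq_0[of c m i] c(1) that \<open>\<And>k. k \<ge> 2 \<Longrightarrow> op_trace m (a ^ k) = 0\<close> by simp
    \<comment> \<open>With all eigenvalues 0, the characteristic polynomial at \<open>a\<close> is a
      pure power.\<close>
    then have "shifted_prod a c k = a ^ k" if "k \<le> m" for k
      using that by (induction k) (simp_all add: linop_scal_simps power_commutes)
    then have "a ^ m * mat_op m (1\<^sub>m m) * a = 0" using c(2) by simp
    then have "a ^ Suc m = 0"
      using mat_op_one(1)[OF A(1)] A(2) by (simp add: power_Suc2 mult.assoc del: power_Suc)
    then show ?thesis by blast
  qed
  show "op_trace m a = 0" if "a \<in> mat_op m ` carrier_mat m m" "a ^ n = 0" for a n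
  proof -
    obtain A where A: "A \<in> carrier_mat m m" "a = mat_op m A" using \<open>a \<in> _\<close> by blast
    obtain c where c: "\<And>k. k > 0 \<Longrightarrow> op_trace m (a ^ k) = Re (\<Sum>i<m. c i ^ k)"
      "\<And>n i. a ^ n = 0 \<Longrightarrow> i < m \<Longrightarrow> c i = 0"
      using eigenvalues_exist[OF A(1)] A(2) by blast
    show ?thesis using c(1)[of 1] c(2)[OF \<open>a ^ n = 0\<close>] by simp
  qed
  show "\<exists>S. finite S \<and> card S \<le> 2 * m ^ 2 \<and> mat_op m ` carrier_mat m m \<subseteq> span S"
  proof -
    \<comment> \<open>Matrix units scaled by \<open>z\<close>; those with \<open>z = 1\<close> and
      \<open>z = \<i>\<close> together span over the reals.\<close>
    define U where "U z p = mat_op m (Matrix.mat m m (\<lambda>q. if q = p then z else 0))" for z p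
    define I where "I = {..<m} \<times> {..<m}"
    have I: "finite I" "card I = m ^ 2" by (simp_all add: I_def power2_eq_square)
    have "mat_op m A \<in> span (U 1 ` I \<union> U \<i> ` I)" if A: "A \<in> carrier_mat m m" for A
    proof -
      have rep: "Rep_linop (\<Sum>p\<in>F. f p) x i = (\<Sum>p\<in>F. Rep_linop (f p) x i)" for F :: "(nat \<times> nat) set" and f x i
        by (induction F rule: infinite_finite_induct) (simp_all add: zero_linop.rep_eq plus_linop.rep_eq)
      have U: "Rep_linop (U z p) x i = (if i = fst p then z * x (snd p) else 0)" if "p \<in> I" for z p x i
        using that by (cases p) (auto simp: U_def I_def mat_op.rep_eq if_zero_mult)
      have "mat_op m A = (\<Sum>p\<in>I. Re (A $$ p) *\<^sub>R U 1 p + Im (A $$ p) *\<^sub>R U \<i> p)"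
      proof (rule linop_eqI)
        fix x i
        have "Rep_linop (\<Sum>p\<in>I. Re (A $$ p) *\<^sub>R U 1 p + Im (A $$ p) *\<^sub>R U \<i> p) x i
            = (\<Sum>p\<in>I. if i = fst p then A $$ p * x (snd p) else 0)"
          unfolding rep
        proof (rule sum.cong)
          fix p assume p: "p \<in> I"
          have "A $$ p = of_real (Re (A $$ p)) + of_real (Im (A $$ p)) * \<i>"
            by (simp add: complex_eq mult.commute)
          then show "Rep_linop (Re (A $$ p) *\<^sub>R U 1 p + Im (A $$ p) *\<^sub>R U \<i> p) x i
              = (if i = fst p then A $$ p * x (snd p) else 0)"
            using p by (simp add: plus_linop.rep_eq scaleR_linop.rep_eq U algebra_simps)
              (metis distrib_right mult.assoc mult.commute)
        qed simp
        also have "\<dots> = (\<Sum>k<m. \<Sum>j<m. if i = k then A $$ (k, j) * x j else 0)"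
          by (simp add: I_def sum.cartesian_product case_prod_beta cong: if_cong)
        also have "\<dots> = Rep_linop (mat_op m A) x i"
        proof -
          have "(\<Sum>j<m. if i = k then A $$ (k, j) * x j else 0)
              = (if i = k then \<Sum>j<m. A $$ (k, j) * x j else 0)" for k
            by simp
          then show ?thesis by (simp add: mat_op.rep_eq)
        qed
        finally show "Rep_linop (mat_op m A) x i
            = Rep_linop (\<Sum>p\<in>I. Re (A $$ p) *\<^sub>R U 1 p + Im (A $$ p) *\<^sub>R U \<i> p) x i" by simp
      qed
      moreover have "Re (A $$ p) *\<^sub>R U 1 p + Im (A $$ p) *\<^sub>R U \<i> p \<in> span (U 1 ` I \<union> U \<i> ` I)"
        if "p \<in> I" for p
        using that by (intro real_vector.span_add real_vector.span_scale real_vector.span_base) auto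
      then have "(\<Sum>p\<in>I. Re (A $$ p) *\<^sub>R U 1 p + Im (A $$ p) *\<^sub>R U \<i> p)
          \<in> span (U 1 ` I \<union> U \<i> ` I)"
        by (rule real_vector.span_sum)
      ultimately show ?thesis by (rule ssubst)
    qed
    moreover have "card (U 1 ` I \<union> U \<i> ` I) \<le> 2 * m ^ 2"
    proof -
      have "card (U 1 ` I \<union> U \<i> ` I) \<le> card (U 1 ` I) + card (U \<i> ` I)" by (rule card_Un_le)
      also have "\<dots> \<le> card I + card I" by (intro add_mono card_image_le I)
      finally show ?thesis using I by simp
    qed
    moreover have "finite (U 1 ` I \<union> U \<i> ` I)" using I(1) by simp
    ultimately show ?thesis by (intro exI[of _ "U 1 ` I \<union> U \<i> ` I"]) (simp add: image_subset_iff)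
  qed
qed

section \<open>Words of matrices\<close>

lemma site_prod_carrier:
  "(\<And>s. s \<in> set w \<Longrightarrow> A s \<in> carrier_mat m m) \<Longrightarrow> site_prod m A w \<in> carrier_mat m m"
  by (induction w) (auto simp: site_prod_def intro!: mult_carrier_mat[of _ m m])

lemma mat_op_site_prod:
  assumes "w \<noteq> []" "\<And>s. s \<in> set w \<Longrightarrow> A s \<in> carrier_mat m m"
  shows "mat_op m (site_prod m A w) = prod_list (map (\<lambda>s. mat_op m (A s)) w)"
  using assms
proof (induction w)
  case (Cons s w)
  have A: "A s \<in> carrier_mat m m" using Cons.prems by simp
  show ?case
  proof (cases "w = []")
    case True
    then show ?thesis using A by (simp add: site_prod_def)
  next
    case False
    have "site_prod m A w \<in> carrier_mat m m" using Cons.prems site_prod_carrier by simp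
    from mat_op_mult[OF A this] show ?thesis
      using Cons False by (simp add: site_prod_def)
  qed
qed simp

text \<open>The quasi-inverse exists with \<open>j = m\<close>, and the real dimension gives
  \<open>D = 2 * m ^ 2\<close>. The real part suffices later because the W state has positive
  coefficients at the words with one 2.\<close>

theorem ex_site_prod_trace_eq_0:
  assumes A: "A 1 \<in> carrier_mat m m" "A 2 \<in> carrier_mat m m" and "m > 0"
    and N: "N \<ge> (2 * m ^ 2 + 2) * (2 * m + 1)"
    and vanish: "\<And>w. length w = N \<Longrightarrow> set w \<subseteq> {1, 2} \<Longrightarrow> count_list w 2 \<ge> 2
      \<Longrightarrow> mat_trace (site_prod m A w) = 0"
  shows "\<exists>w. length w = N \<and> set w \<subseteq> {1, 2} \<and> count_list w 2 = 1
    \<and> Re (mat_trace (site_prod m A w)) = 0"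
proof -
  interpret trace_algebra "mat_op m ` carrier_mat m m" "op_trace m" "2 * m ^ 2"
    by (rule trace_algebra_matrices)
  obtain X' where X': "X' \<in> carrier_mat m m" "mat_op m (A 1) * mat_op m X' = mat_op m X' * mat_op m (A 1)"
    "mat_op m (A 1) ^ Suc m * mat_op m X' = mat_op m (A 1) ^ m"
    using mat_op_quasi_inverse[OF A(1) \<open>m > 0\<close>] by blast
  have "N > 0" using N by (cases N) auto
  then have tr: "op_trace m (prod_list (map (\<lambda>s. mat_op m (A s)) w)) = Re (mat_trace (site_prod m A w))"
    if "length w = N" "set w \<subseteq> {1, 2}" for w
  proof -
    have Aw: "A s \<in> carrier_mat m m" if "s \<in> set w" for s using that \<open>set w \<subseteq> {1, 2}\<close> A by auto
    have "w \<noteq> []" using \<open>N > 0\<close> \<open>length w = N\<close> by auto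
    then have "mat_op m (site_prod m A w) = prod_list (map (\<lambda>s. mat_op m (A s)) w)"
      using Aw by (rule mat_op_site_prod)
    moreover have "site_prod m A w \<in> carrier_mat m m"
      using Aw by (rule site_prod_carrier)
    ultimately show ?thesis
      using op_trace_mat_op[of m "site_prod m A w"] by (simp add: mat_trace_def)
  qed
  have "\<exists>w. length w = N \<and> set w \<subseteq> {1, 2} \<and> count_list w 2 = 1
      \<and> op_trace m (prod_list (map (\<lambda>s. mat_op m (A s)) w)) = 0"
    by (rule ex_word_tr_eq_0[where A = "\<lambda>s. mat_op m (A s)", OF _ _ _ X'(2,3) \<open>m > 0\<close> N]) (use A X'(1) vanish tr in auto)
  then show ?thesis using tr by auto
qed

section \<open>The W state\<close>

text \<open>At \<open>\<epsilon> = 0\<close> the convention \<open>0 ^ 0 = 1\<close> singles out the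
  words with exactly one 2, which gives the W state.\<close>

definition border_state :: "nat \<Rightarrow> nat \<Rightarrow> real \<Rightarrow> nat list \<Rightarrow> complex" where
  "border_state N d \<epsilon> \<sigma> = (if \<sigma> \<in> configs N d \<and> set \<sigma> \<subseteq> {1, 2} \<and> count_list \<sigma> 2 \<noteq> 0
     then of_real (\<epsilon> ^ (count_list \<sigma> 2 - 1)) else 0)"

lemma mat_trace_site_prod_diagonal:
  assumes "\<And>s. A s = Matrix.mat m m (\<lambda>(i, j). if i = j then f s i else 0)"
  shows "mat_trace (site_prod m A w) = (\<Sum>i<m. \<Prod>s\<leftarrow>w. f s i)"
proof -
  have "site_prod m A w = Matrix.mat m m (\<lambda>(i, j). if i = j then \<Prod>s\<leftarrow>w. f s i else 0)"
  proof (induction w)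
    case Nil
    then show ?case by (auto simp: site_prod_def)
  next
    case (Cons s w)
    have "site_prod m A (s # w) = A s * site_prod m A w" by (simp add: site_prod_def)
    also have "\<dots> = Matrix.mat m m (\<lambda>(i, j). if i = j then \<Prod>s\<leftarrow>s # w. f s i else 0)"
      unfolding Cons assms
      by (rule eq_matI) (auto simp: scalar_prod_def if_zero_mult)
    finally show ?case .
  qed
  then show ?thesis by (simp add: mat_trace_def)
qed

lemma prod_list_two_letters:
  fixes \<kappa> \<epsilon> :: complex
  shows "(\<Prod>s\<leftarrow>w. if s = 1 then \<kappa> else if s = 2 then \<kappa> * \<epsilon> else 0)
    = (if set w \<subseteq> {1, 2 :: nat} then \<kappa> ^ length w * \<epsilon> ^ count_list w 2 else 0)"
  by (induction w) auto

text \<open>Up to a factor, \<open>border_state\<close> is \<open>(|1\<rangle> + \<epsilon> |2\<rangle>)\<^sup>\<otimes>\<^sup>N - |1\<rangle>\<^sup>\<otimes>\<^sup>N\<close>, divided by \<open>\<epsilon>\<close>; the minus sign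
  is the \<open>N\<close>-th power of the eigenvalue \<open>-\<kappa>\<close>, so \<open>N\<close> has to be odd.\<close>

lemma border_state_mps:
  fixes \<kappa> \<epsilon> :: real
  assumes "m \<ge> 2" "odd N"
  shows "\<exists>A. (\<forall>s. A s \<in> carrier_mat m m)
    \<and> mps_state N m d A = (\<lambda>\<sigma>. of_real (\<kappa> ^ N * \<epsilon>) * border_state N d \<epsilon> \<sigma>)"
proof -
  define g :: "complex \<Rightarrow> complex \<Rightarrow> nat \<Rightarrow> complex" where
    "g \<kappa> \<epsilon> s = (if s = 1 then \<kappa> else if s = 2 then \<kappa> * \<epsilon> else 0)" for \<kappa> \<epsilon> s
  define f where "f s i = (if i = 0 then g \<kappa> \<epsilon> s else if i = 1 then g (- \<kappa>) 0 s else 0)" for s i :: nat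
  define A where "A s = Matrix.mat m m (\<lambda>(i, j). if i = j then f s i else 0)" for s
  have N: "N > 0" using assms(2) by (cases N) auto
  have tr: "mat_trace (site_prod m A \<sigma>) = of_real (\<kappa> ^ N * \<epsilon>) * border_state N d \<epsilon> \<sigma>"
    if \<sigma>: "\<sigma> \<in> configs N d" for \<sigma>
  proof -
    have len: "length \<sigma> = N" using \<sigma> by (simp add: configs_def)
    then have "\<sigma> \<noteq> []" using N by auto
    \<comment> \<open>The word is nonempty, so the zero diagonal entries beyond the first two do not
      contribute an empty product 1.\<close>
    then have "(\<Prod>s\<leftarrow>\<sigma>. f s i) = 0" if "i \<ge> 2" for i
      using that by (cases \<sigma>) (auto simp: f_def)
    then have "(\<Sum>i\<in>{0..<m}. \<Prod>s\<leftarrow>\<sigma>. f s i) = (\<Sum>i\<in>{0..<2}. \<Prod>s\<leftarrow>\<sigma>. f s i)"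
      using assms(1) by (intro sum.mono_neutral_right) auto
    also have "\<dots> = (\<Prod>s\<leftarrow>\<sigma>. g \<kappa> \<epsilon> s) + (\<Prod>s\<leftarrow>\<sigma>. g (- \<kappa>) 0 s)"
      by (simp add: f_def numeral_2_eq_2)
    also have "\<dots> = of_real (\<kappa> ^ N * \<epsilon>) * border_state N d \<epsilon> \<sigma>"
      unfolding g_def prod_list_two_letters len
      \<comment> \<open>Without a 2 the two product states cancel, since \<open>0 ^ 0 = 1\<close>
        and \<open>N\<close> is odd. With a 2 the second one vanishes, and one factor
        \<open>\<epsilon>\<close> is split off from the first.\<close>
      using assms(2) \<sigma> by (cases "count_list \<sigma> 2") (auto simp: border_state_def)
    finally show ?thesis
      using mat_trace_site_prod_diagonal[of A m f \<sigma>] by (simp add: A_def atLeast0LessThan)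
  qed
  have "mps_state N m d A = (\<lambda>\<sigma>. of_real (\<kappa> ^ N * \<epsilon>) * border_state N d \<epsilon> \<sigma>)"
    by (rule ext) (auto simp: mps_state_def tr border_state_def)
  moreover have "A s \<in> carrier_mat m m" for s by (simp add: A_def)
  ultimately show ?thesis by blast
qed

section \<open>Normalization and convergence to the W state\<close>

lemma tensor_norm_scale: "tensor_norm N d (\<lambda>\<sigma>. c * \<psi> \<sigma>) = cmod c * tensor_norm N d \<psi>"
  by (simp add: tensor_norm_def norm_mult L2_set_right_distrib)

lemma border_state_norm_pos:
  assumes "N > 0" "d \<ge> 2"
  shows "tensor_norm N d (border_state N d \<epsilon>) > 0"
proof -
  \<comment> \<open>This word has a single 2, hence coefficient 1 for every
    \<open>\<epsilon>\<close>.\<close>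
  define \<sigma> :: "nat list" where "\<sigma> = 2 # replicate (N - 1) 1"
  have "\<sigma> \<in> configs N d" using assms by (auto simp: \<sigma>_def configs_def)
  moreover have "border_state N d \<epsilon> \<sigma> = 1"
    using calculation by (auto simp: border_state_def) (auto simp: \<sigma>_def)
  ultimately have "\<not> (\<forall>\<sigma>\<in>configs N d. cmod (border_state N d \<epsilon> \<sigma>) = 0)"
    by (metis norm_one zero_neq_one)
  then have "tensor_norm N d (border_state N d \<epsilon>) \<noteq> 0"
    by (simp add: tensor_norm_def L2_set_eq_0_iff finite_configs)
  moreover have "tensor_norm N d (border_state N d \<epsilon>) \<ge> 0"
    by (simp add: tensor_norm_def)
  ultimately show ?thesis by simp
qed

definition unit_border_state :: "nat \<Rightarrow> nat \<Rightarrow> real \<Rightarrow> nat list \<Rightarrow> complex" where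
  "unit_border_state N d \<epsilon> \<sigma> =
     of_real (inverse (tensor_norm N d (border_state N d \<epsilon>))) * border_state N d \<epsilon> \<sigma>"

lemma unit_border_state_tiMPS:
  assumes "m \<ge> 2" "odd N" "d \<ge> 2" "\<epsilon> > 0"
  shows "unit_border_state N d \<epsilon> \<in> tiMPS N m d"
proof -
  have N: "N > 0" using assms(2) by (cases N) auto
  define t where "t = tensor_norm N d (border_state N d \<epsilon>)"
  have t: "t > 0" unfolding t_def by (rule border_state_norm_pos[OF N assms(3)])
  \<comment> \<open>The real \<open>N\<close>-th root absorbs both the normalization and the
    division by \<open>\<epsilon>\<close>.\<close>
  define \<kappa> where "\<kappa> = root N (inverse t / \<epsilon>)"
  have "\<kappa> ^ N * \<epsilon> = inverse t"
    using N t assms(4) by (simp add: \<kappa>_def)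
  then obtain A where A: "\<forall>s. A s \<in> carrier_mat m m" "mps_state N m d A = unit_border_state N d \<epsilon>"
    using border_state_mps[OF assms(1,2), of d \<kappa> \<epsilon>]
    by (auto simp: unit_border_state_def[abs_def] t_def)
  moreover have "tensor_norm N d (unit_border_state N d \<epsilon>) = 1"
    unfolding unit_border_state_def[abs_def] tensor_norm_scale
    using t by (simp add: t_def norm_inverse)
  ultimately show ?thesis
    unfolding tiMPS_def mem_Collect_eq by (intro exI[of _ A]) simp
qed

text \<open>The coefficients are polynomials in \<open>\<epsilon>\<close> and the norm depends
  continuously on them; the norm is positive in the limit, so dividing by it preserves
  convergence.\<close>

lemma unit_border_state_tendsto:
  assumes "N > 0" "d \<ge> 2" "\<epsilon> \<longlonglongrightarrow> 0"
  shows "(\<lambda>n. tensor_dist N d (unit_border_state N d (\<epsilon> n)) (unit_border_state N d 0)) \<longlonglongrightarrow> 0"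
proof -
  have b: "(\<lambda>n. border_state N d (\<epsilon> n) \<sigma>) \<longlonglongrightarrow> border_state N d 0 \<sigma>" for \<sigma>
  proof -
    have "(\<lambda>n. complex_of_real (\<epsilon> n ^ k)) \<longlonglongrightarrow> of_real (0 ^ k)" for k
      by (intro tendsto_of_real tendsto_power assms(3))
    then show ?thesis
      by (cases "\<sigma> \<in> configs N d \<and> set \<sigma> \<subseteq> {1, 2} \<and> count_list \<sigma> 2 \<noteq> 0")
        (simp_all only: border_state_def if_True if_False tendsto_const simp_thms)
  qed
  have "(\<lambda>n. tensor_norm N d (border_state N d (\<epsilon> n))) \<longlonglongrightarrow> tensor_norm N d (border_state N d 0)"
    unfolding tensor_norm_def L2_set_def by (intro tendsto_intros b)
  then have "(\<lambda>n. unit_border_state N d (\<epsilon> n) \<sigma>) \<longlonglongrightarrow> unit_border_state N d 0 \<sigma>" for \<sigma>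
    unfolding unit_border_state_def
    using border_state_norm_pos[OF assms(1,2), of 0] by (intro tendsto_intros b) auto
  then have "(\<lambda>n. tensor_dist N d (unit_border_state N d (\<epsilon> n)) (unit_border_state N d 0))
      \<longlonglongrightarrow> tensor_dist N d (unit_border_state N d 0) (unit_border_state N d 0)"
    unfolding tensor_dist_def tensor_norm_def L2_set_def by (intro tendsto_intros)
  then show ?thesis by (simp add: tensor_dist_def tensor_norm_def L2_set_def)
qed

lemma unit_border_state_0_notin_tiMPS:
  assumes "m > 0" "d \<ge> 2" "N \<ge> (2 * m ^ 2 + 2) * (2 * m + 1)"
  shows "unit_border_state N d 0 \<notin> tiMPS N m d"
proof
  assume "unit_border_state N d 0 \<in> tiMPS N m d"
  then obtain A where A: "\<forall>s\<in>{1..d}. A s \<in> carrier_mat m m"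
    "unit_border_state N d 0 = mps_state N m d A"
    by (auto simp: tiMPS_def)
  have N: "N > 0" using assms(3) by (cases N) auto
  have tr: "mat_trace (site_prod m A w) = unit_border_state N d 0 w" "w \<in> configs N d"
    if "length w = N" "set w \<subseteq> {1, 2}" for w
  proof -
    show "w \<in> configs N d" using that assms(2) by (auto simp: configs_def)
    then show "mat_trace (site_prod m A w) = unit_border_state N d 0 w"
      by (simp add: A(2) mps_state_def)
  qed
  have "\<exists>w. length w = N \<and> set w \<subseteq> {1, 2} \<and> count_list w 2 = 1
      \<and> Re (mat_trace (site_prod m A w)) = 0"
  proof (rule ex_site_prod_trace_eq_0[OF _ _ assms(1,3)])
    show "A 1 \<in> carrier_mat m m" "A 2 \<in> carrier_mat m m" using A(1) assms(2) by auto
    show "mat_trace (site_prod m A w) = 0"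
      if "length w = N" "set w \<subseteq> {1, 2}" "count_list w 2 \<ge> 2" for w
      using tr[OF that(1,2)] that(3) by (simp add: unit_border_state_def border_state_def)
  qed
  then obtain w where w: "length w = N" "set w \<subseteq> {1, 2}" "count_list w 2 = 1"
    "Re (mat_trace (site_prod m A w)) = 0" by blast
  \<comment> \<open>At a word with a single 2 the coefficient is the inverse of the norm, a positive
    real.\<close>
  then show False
    using tr[OF w(1,2)] border_state_norm_pos[OF N assms(2), of 0]
    by (simp add: unit_border_state_def border_state_def)
qed

lemma tiMPS_not_closed:
  assumes "m \<ge> 2" "d \<ge> 2" "odd N" "N \<ge> (2 * m ^ 2 + 2) * (2 * m + 1)"
  shows "\<not> closedin (tensor_topology N d) (tiMPS N m d)"
proof
  assume closed: "closedin (tensor_topology N d) (tiMPS N m d)"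
  interpret Metric_space "tensor_space N d" "tensor_dist N d" by (rule Metric_space_tensor)
  have N: "N > 0" using assms(3) by (cases N) auto
  define \<psi> where "\<psi> n = unit_border_state N d (inverse (real (Suc n)))" for n
  have space: "unit_border_state N d \<epsilon> \<in> tensor_space N d" for \<epsilon>
    by (simp add: tensor_space_def unit_border_state_def border_state_def)
  have "range \<psi> \<subseteq> tiMPS N m d"
    unfolding \<psi>_def by (intro image_subsetI unit_border_state_tiMPS assms) simp
  moreover have "limitin mtopology \<psi> (unit_border_state N d 0) sequentially"
    unfolding limitin_metric_dist_null \<psi>_def
    using space unit_border_state_tendsto[OF N assms(2) LIMSEQ_inverse_real_of_nat] by simp
  ultimately have "unit_border_state N d 0 \<in> tiMPS N m d"
    using closed unfolding tensor_topology_def metric_closedin_iff_sequentially_closed by blast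
  then show False using unit_border_state_0_notin_tiMPS assms by simp
qed

theorem proposition4:
  fixes m :: nat
  assumes "m \<ge> 2"
  shows "\<exists>N\<^sub>c :: real. \<forall>d :: nat. d \<ge> 2 \<longrightarrow>
    2 * log (real d) (real m) < N\<^sub>c \<and>
    N\<^sub>c \<le> 12 * real m ^ 3 * (7 + log 2 (real m)) \<and>
    (\<forall>N :: nat. prime N \<and> real N > N\<^sub>c \<longrightarrow>
      \<not> closedin (tensor_topology N d) (tiMPS N m d))"
proof (intro exI allI impI conjI)
  fix d :: nat assume d: "d \<ge> 2"
  have log2: "log 2 (real m) \<ge> 0" using assms by simp
  have m3: "real m ^ 3 \<ge> 1" using assms by simp
  have "log (real d) (real m) \<le> log 2 (real m)"
    using d assms by (simp add: log_def frac_le)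
  then have "2 * log (real d) (real m) < 84 + 12 * log 2 (real m)"
    using log2 by linarith
  also have "\<dots> = 12 * (7 + log 2 (real m))" by (simp add: distrib_left)
  also have "\<dots> \<le> 12 * real m ^ 3 * (7 + log 2 (real m))"
    using m3 log2 by (intro mult_right_mono) auto
  \<comment> \<open>This fixes the witness \<open>N\<^sub>c\<close> as the upper bound itself, one
    value for all \<open>d\<close>.\<close>
  finally show "2 * log (real d) (real m) < 12 * real m ^ 3 * (7 + log 2 (real m))" .
  fix N :: nat assume N: "prime N \<and> real N > 12 * real m ^ 3 * (7 + log 2 (real m))"
  have "12 * real m ^ 3 * (7 + log 2 (real m)) \<ge> 12 * real m ^ 3 * 7"
    using log2 by (intro mult_left_mono) auto
  then have "real N > real (84 * m ^ 3)" using N by simp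
  then have N84: "N > 84 * m ^ 3" by (simp only: of_nat_less_iff)
  \<comment> \<open>The required length is at most \<open>12 * m ^ 3\<close>, well below
    \<open>84 * m ^ 3\<close>.\<close>
  have "(2 * m ^ 2 + 2) * (2 * m + 1) = 4 * m ^ 3 + 2 * m ^ 2 + 4 * m + 2"
    by (simp add: algebra_simps power2_eq_square power3_eq_cube)
  moreover have "m ^ 2 \<le> m ^ 3" "m ^ 1 \<le> m ^ 3" "m ^ 0 \<le> m ^ 3"
    using assms by (intro power_increasing; simp)+
  ultimately have "(2 * m ^ 2 + 2) * (2 * m + 1) \<le> N" using N84 by simp
  \<comment> \<open>A prime above 2 is odd, as the approximating states require.\<close>
  moreover have "odd N"
    using N N84 \<open>m ^ 0 \<le> m ^ 3\<close> by (intro prime_odd_nat) auto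
  ultimately show "\<not> closedin (tensor_topology N d) (tiMPS N m d)"
    using tiMPS_not_closed assms d by blast
qed simp

end
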